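(* Let $\mathcal H$ be a separable Hilbert space and $\mathcal K$ another Hilbert space. Let $\rho_0\in\mathcal S(\mathcal H)$ be a faithful state and let $\Omega$ be a minimal GNS-vector for $\rho_0$. (a) Let $\Phi\in\mathbf{NCH}(\mathcal H,\mathcal K)$ and let $\{K_\lambda\}_{\lambda\in L}$, $L\neq\emptyset$, be a set of Kraus operators for $\Phi$ such that $\mathrm{tr}[\rho_0K_\lambda^*K_{\lambda'}]=0$ whenever $\lambda\neq\lambda'$. Then the set $\{w_\lambda\}_{\lambda\in L}\subset\mathcal H\otimes\mathcal K$, $w_\lambda=(\mathbb 1_{\mathcal H}\otimes K_\lambda)\Omega$, $\lambda\in L$, is orthogonal and $S_\Omega^\Phi=\sum_{\lambda\in L}|w_\lambda\rangle\langle w_\lambda|$. (b) Suppose that $S\in\mathcal S(\mathcal H\otimes\mathcal K)$ is such that $\mathrm{tr}_{\mathcal K}[S]=\rho_0$, and let $\Phi\in\mathbf{NCH}(\mathcal H,\mathcal K)$ be the channel such that $S=S_\Omega^\Phi$. For any orthogonal decomposition $S=\sum_{\lambda\in L}|w_\lambda\rangle\langle w_\lambda|$ such that $w_\lambda\in(\mathcal H\otimes\mathcal K)\setminus\{0\}$ for all $\lambda\in L$, $L\neq\emptyset$, there is a minimal set $\{K_\lambda\}_{\lambda\in L}$ of Kraus operators for $\Phi$ such that $\mathrm{tr}[\rho_0K_\lambda^*K_{\lambda'}]=0$ whenever $\lambda\neq\lambda'$ and $w_\lambda=(\mathbb 1_{\mathcal H}\otimes K_\lambda)\Omega$ for all $\lambda\in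 L$.
   Context: Inner products are linear in the second argument; $\mathbb 1_{\mathcal H}$ is the identity operator of $\mathcal H$, and $\mathcal L(\mathcal H)$ is the algebra of bounded operators on $\mathcal H$. $\mathcal S(\mathcal H)$ is the set of positive trace-class operators of trace 1 on $\mathcal H$ (states); a state is faithful if it is injective as an operator. $\mathrm{tr}_{\mathcal K}$ is the partial trace over $\mathcal K$. $\mathbf{NCH}(\mathcal H,\mathcal K)$ is the set of normal unital completely positive linear maps $\Phi:\mathcal L(\mathcal K)\to\mathcal L(\mathcal H)$ (normal channels in the Heisenberg picture). A minimal GNS-vector for $\rho_0$ is a unit vector $\Omega\in\mathcal H\otimes\mathcal H$, where $\mathcal L(\mathcal H)$ acts on $\mathcal H\otimes\mathcal H$ by $A\mapsto A\otimes\mathbb 1_{\mathcal H}$, such that $\langle\Omega|(A\otimes\mathbb 1_{\mathcal H})\Omega\rangle=\mathrm{tr}[\rho_0A]$ for all $A\in\mathcal L(\mathcal H)$ and the vectors $(A\otimes\mathbb 1_{\mathcal H})\Omega$, $A\in\mathcal L(\mathcal H)$, span a dense subspace of $\mathcal H\otimes\mathcal H$. An example is $\Omega=\sum_{\xi\in K}\sqrt{t_\xi}\,\xi\otimes\xi$, where $\rho_0=\sum_{\xi\in K}t_\xi|\xi\rangle\langle\xi|$ is a spectral decomposition with an orthonormal basis $K$ of $\mathcal H$. For $\Phi\in\mathbf{NCH}(\mathcal H,\mathcal K)$, the (normal) Choi-Jamiołkowski state $S_\Omega^\Phi\in\mathcal S(\mathcal H\otimes\mathcal K)$ is determined by $$\mathrm{tr}[S_\Omega^\Phi(A'\otimes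 B)]=\langle\Omega|(\Phi(B)\otimes A')\Omega\rangle,\qquad A'\in\mathcal L(\mathcal H),\ B\in\mathcal L(\mathcal K).$$ Linear operators $K_\lambda:\mathcal H\to\mathcal K$, $\lambda\in L$, $L\neq\emptyset$, are Kraus operators for $\Phi$ if $\Phi(B)=\sum_{\lambda\in L}K_\lambda^*BK_\lambda$ for all $B\in\mathcal L(\mathcal K)$, the series converging weakly. They form a minimal set of Kraus operators for $\Phi$ if they are, in addition, weakly independent: whenever complex numbers $\alpha_\lambda$, $\lambda\in L$, satisfy $\sum_{\lambda\in L}|\alpha_\lambda|^2<\infty$ and $\sum_{\lambda\in L}\alpha_\lambda\langle\psi|K_\lambda\varphi\rangle=0$ for all $\varphi\in\mathcal H$ and $\psi\in\mathcal K$, then $\alpha_\lambda=0$ for all $\lambda\in L$. An orthogonal decomposition $S=\sum_{\lambda\in L}|w_\lambda\rangle\langle w_\lambda|$ is one in which $\langle w_\lambda|w_{\lambda'}\rangle=0$ whenever $\lambda\neq\lambda'$.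
   Formalization: In w_λ=(1⊗K_λ)Ω, in (a) and (b), Ω is replaced by Ω with its two tensor factors exchanged; the formula as written fails for Ω=√t₁ e₁⊗e₂+√t₂ e₂⊗e₁ with t₁≠t₂, and the two agree when Ω is symmetric. *)

theory Defs
  imports "HOL-Analysis.Analysis"
begin

section \<open>Complex Hilbert spaces\<close>

text \<open>The inner product is linear in the second argument. Positive definiteness is part of
  \<open>cinner_self\<close>, because \<open>norm\<close> is a norm; completeness comes from \<open>banach\<close>.\<close>

class chilbert = banach +
  fixes scaleC :: "complex \<Rightarrow> 'a \<Rightarrow> 'a" (infixr "*\<^sub>C" 75)
    and cinner :: "'a \<Rightarrow> 'a \<Rightarrow> complex"
  assumes scaleC_add_right: "c *\<^sub>C (x + y) = c *\<^sub>C x + c *\<^sub>C y"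
    and scaleC_add_left: "(c + d) *\<^sub>C x = c *\<^sub>C x + d *\<^sub>C x"
    and scaleC_scaleC: "c *\<^sub>C d *\<^sub>C x = (c * d) *\<^sub>C x"
    and scaleC_one: "1 *\<^sub>C x = x"
    and scaleR_scaleC: "r *\<^sub>R x = complex_of_real r *\<^sub>C x"
    and cinner_commute: "cinner x y = cnj (cinner y x)"
    and cinner_add_right: "cinner x (y + z) = cinner x y + cinner x z"
    and cinner_scaleC_right: "cinner x (c *\<^sub>C y) = c * cinner x y"
    and cinner_self: "cinner x x = complex_of_real ((norm x)\<^sup>2)"

instantiation complex :: chilbert
begin

definition scaleC_complex :: "complex \<Rightarrow> complex \<Rightarrow> complex"
  where "scaleC_complex c x = c * x"

definition cinner_complex :: "complex \<Rightarrow> complex \<Rightarrow> complex"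
  where "cinner_complex x y = cnj x * y"

instance
  by standard
    (simp_all add: scaleC_complex_def cinner_complex_def algebra_simps scaleR_conv_of_real
      complex_norm_square[symmetric] flip: complex_norm_square of_real_power)

end

lemma vector_space_scaleC: "vector_space (scaleC :: complex \<Rightarrow> 'a \<Rightarrow> 'a::chilbert)"
  by standard (simp_all add: scaleC_add_right scaleC_add_left scaleC_scaleC scaleC_one)

definition cspan :: "'a::chilbert set \<Rightarrow> 'a set"
  where "cspan = module.span scaleC"

definition is_onb :: "'a::chilbert set \<Rightarrow> bool"
  where "is_onb E \<longleftrightarrow> (\<forall>e\<in>E. norm e = 1) \<and>
    (\<forall>e\<in>E. \<forall>f\<in>E. e \<noteq> f \<longrightarrow> cinner e f = 0) \<and> closure (cspan E) = UNIV"

definition separable_type :: "'a::topological_space itself \<Rightarrow> bool"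
  where "separable_type _ \<longleftrightarrow> (\<exists>D::'a set. countable D \<and> closure D = UNIV)"


section \<open>Bounded operators, trace class and states\<close>

definition bounded_clinear :: "('a::chilbert \<Rightarrow> 'b::chilbert) \<Rightarrow> bool"
  where "bounded_clinear A \<longleftrightarrow>
    Vector_Spaces.linear scaleC scaleC A \<and> (\<exists>M. \<forall>x. norm (A x) \<le> M * norm x)"

definition adj :: "('a::chilbert \<Rightarrow> 'b::chilbert) \<Rightarrow> 'b \<Rightarrow> 'a"
  where "adj A = (THE B. bounded_clinear B \<and> (\<forall>x y. cinner (B x) y = cinner x (A y)))"

definition positive_op :: "('a::chilbert \<Rightarrow> 'a) \<Rightarrow> bool"
  where "positive_op A \<longleftrightarrow> bounded_clinear A \<and> (\<forall>x. cinner x (A x) \<in> \<real>\<^sub>\<ge>\<^sub>0)"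

text \<open>In the next definition \<open>P\<close> is the absolute value of \<open>T\<close>, the positive square root
  of \<open>adj T \<circ> T\<close>.\<close>

definition trace_class :: "('a::chilbert \<Rightarrow> 'a) \<Rightarrow> bool"
  where "trace_class T \<longleftrightarrow> bounded_clinear T \<and>
    (\<exists>P. positive_op P \<and> P \<circ> P = adj T \<circ> T \<and>
      (\<exists>E. is_onb E \<and> (\<lambda>e. cinner e (P e)) summable_on E))"

text \<open>The trace of a trace-class operator does not depend on the orthonormal basis.\<close>

definition op_trace :: "('a::chilbert \<Rightarrow> 'a) \<Rightarrow> complex"
  where "op_trace T = (\<Sum>\<^sub>\<infinity>e\<in>(SOME E. is_onb E). cinner e (T e))"

definition states :: "('a::chilbert \<Rightarrow> 'a) set"
  where "states = {\<rho>. positive_op \<rho> \<and> trace_class \<rho> \<and> op_trace \<rho> = 1}"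

definition faithful :: "('a::chilbert \<Rightarrow> 'a) \<Rightarrow> bool"
  where "faithful \<rho> \<longleftrightarrow> inj \<rho>"


section \<open>Hilbert tensor products\<close>

text \<open>\<open>hilbert_tensor t\<close> says that the type \<open>'c\<close>, with \<open>t x y\<close> as the elementary tensor of
  \<open>x\<close> and \<open>y\<close>, is the Hilbert tensor product of \<open>'a\<close> and \<open>'b\<close>. This determines the pair
  up to a unique unitary that respects elementary tensors.\<close>

definition hilbert_tensor :: "('a::chilbert \<Rightarrow> 'b::chilbert \<Rightarrow> 'c::chilbert) \<Rightarrow> bool"
  where "hilbert_tensor t \<longleftrightarrow>
    (\<forall>x. Vector_Spaces.linear scaleC scaleC (\<lambda>y. t x y)) \<and>
    (\<forall>y. Vector_Spaces.linear scaleC scaleC (\<lambda>x. t x y)) \<and>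
    (\<forall>x y x' y'. cinner (t x y) (t x' y') = cinner x x' * cinner y y') \<and>
    closure (cspan {t x y | x y. True}) = UNIV"

text \<open>The operator \<open>A \<otimes> B\<close>, from the tensor product given by \<open>t\<close> to the one given by \<open>t'\<close>.\<close>

definition tensor_op ::
  "('a::chilbert \<Rightarrow> 'b::chilbert \<Rightarrow> 'c::chilbert) \<Rightarrow>
   ('a'::chilbert \<Rightarrow> 'b'::chilbert \<Rightarrow> 'c'::chilbert) \<Rightarrow>
   ('a \<Rightarrow> 'a') \<Rightarrow> ('b \<Rightarrow> 'b') \<Rightarrow> 'c \<Rightarrow> 'c'"
  where "tensor_op t t' A B =
    (THE C. bounded_clinear C \<and> (\<forall>x y. C (t x y) = t' (A x) (B y)))"

definition tensor_flip :: "('a::chilbert \<Rightarrow> 'a \<Rightarrow> 'c::chilbert) \<Rightarrow> 'c \<Rightarrow> 'c"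
  where "tensor_flip t = (THE F. bounded_clinear F \<and> (\<forall>x y. F (t x y) = t y x))"

text \<open>The partial trace over the second factor.\<close>

definition partial_trace ::
  "('a::chilbert \<Rightarrow> 'b::chilbert \<Rightarrow> 'c::chilbert) \<Rightarrow> ('c \<Rightarrow> 'c) \<Rightarrow> 'a \<Rightarrow> 'a"
  where "partial_trace t S = (THE T. trace_class T \<and>
    (\<forall>A. bounded_clinear A \<longrightarrow> op_trace (T \<circ> A) = op_trace (S \<circ> tensor_op t t A id)))"


section \<open>Normal channels in the Heisenberg picture\<close>

text \<open>A map on bounded operators is represented by a function whose values matter only on
  bounded operators. Positivity of an \<open>n \<times> n\<close> operator matrix means positivity as an operator
  on the \<open>n\<close>-fold direct sum.\<close>

definition positive_op_matrix :: "nat \<Rightarrow> (nat \<Rightarrow> nat \<Rightarrow> 'a::chilbert \<Rightarrow> 'a) \<Rightarrow> bool"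
  where "positive_op_matrix n B \<longleftrightarrow>
    (\<forall>i<n. \<forall>j<n. bounded_clinear (B i j)) \<and>
    (\<forall>\<psi>. (\<Sum>i<n. \<Sum>j<n. cinner (\<psi> i) (B i j (\<psi> j))) \<in> \<real>\<^sub>\<ge>\<^sub>0)"

definition completely_positive ::
  "(('b::chilbert \<Rightarrow> 'b) \<Rightarrow> 'a::chilbert \<Rightarrow> 'a) \<Rightarrow> bool"
  where "completely_positive \<Phi> \<longleftrightarrow>
    (\<forall>n B. positive_op_matrix n B \<longrightarrow> positive_op_matrix n (\<lambda>i j. \<Phi> (B i j)))"

definition op_linear :: "(('b::chilbert \<Rightarrow> 'b) \<Rightarrow> 'a::chilbert \<Rightarrow> 'a) \<Rightarrow> bool"
  where "op_linear \<Phi> \<longleftrightarrow>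
    (\<forall>A. bounded_clinear A \<longrightarrow> bounded_clinear (\<Phi> A)) \<and>
    (\<forall>A B. bounded_clinear A \<longrightarrow> bounded_clinear B \<longrightarrow>
      \<Phi> (\<lambda>x. A x + B x) = (\<lambda>x. \<Phi> A x + \<Phi> B x)) \<and>
    (\<forall>c A. bounded_clinear A \<longrightarrow> \<Phi> (\<lambda>x. c *\<^sub>C A x) = (\<lambda>x. c *\<^sub>C \<Phi> A x))"

definition selfadjoint_op :: "('a::chilbert \<Rightarrow> 'a) \<Rightarrow> bool"
  where "selfadjoint_op A \<longleftrightarrow> bounded_clinear A \<and> adj A = A"

definition op_le :: "('a::chilbert \<Rightarrow> 'a) \<Rightarrow> ('a \<Rightarrow> 'a) \<Rightarrow> bool"
  where "op_le A B \<longleftrightarrow> positive_op (\<lambda>x. B x - A x)"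

definition op_directed :: "('a::chilbert \<Rightarrow> 'a) set \<Rightarrow> bool"
  where "op_directed D \<longleftrightarrow> D \<noteq> {} \<and> (\<forall>A\<in>D. selfadjoint_op A) \<and>
    (\<forall>A\<in>D. \<forall>B\<in>D. \<exists>C\<in>D. op_le A C \<and> op_le B C)"

definition op_is_sup :: "('a::chilbert \<Rightarrow> 'a) set \<Rightarrow> ('a \<Rightarrow> 'a) \<Rightarrow> bool"
  where "op_is_sup D B \<longleftrightarrow> selfadjoint_op B \<and> (\<forall>A\<in>D. op_le A B) \<and>
    (\<forall>C. selfadjoint_op C \<and> (\<forall>A\<in>D. op_le A C) \<longrightarrow> op_le B C)"

definition normal_map :: "(('b::chilbert \<Rightarrow> 'b) \<Rightarrow> 'a::chilbert \<Rightarrow> 'a) \<Rightarrow> bool"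
  where "normal_map \<Phi> \<longleftrightarrow>
    (\<forall>D B. op_directed D \<and> op_is_sup D B \<longrightarrow> op_is_sup (\<Phi> ` D) (\<Phi> B))"

definition NCH :: "(('b::chilbert \<Rightarrow> 'b) \<Rightarrow> 'a::chilbert \<Rightarrow> 'a) set"
  where "NCH = {\<Phi>. op_linear \<Phi> \<and> completely_positive \<Phi> \<and> \<Phi> id = id \<and> normal_map \<Phi>}"


section \<open>GNS vectors, Choi-Jamiolkowski states and Kraus operators\<close>

definition minimal_gns ::
  "('a::chilbert \<Rightarrow> 'a \<Rightarrow> 'c::chilbert) \<Rightarrow> ('a \<Rightarrow> 'a) \<Rightarrow> 'c \<Rightarrow> bool"
  where "minimal_gns t \<rho> \<Omega> \<longleftrightarrow> norm \<Omega> = 1 \<and>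
    (\<forall>A. bounded_clinear A \<longrightarrow> cinner \<Omega> (tensor_op t t A id \<Omega>) = op_trace (\<rho> \<circ> A)) \<and>
    closure (cspan {tensor_op t t A id \<Omega> | A. bounded_clinear A}) = UNIV"

text \<open>\<open>is_choi_state t t' \<Omega> \<Phi> S\<close>: the state \<open>S\<close> is the Choi-Jamiolkowski state of \<open>\<Phi>\<close>. In
  \<open>A' \<otimes> B\<close> the operator \<open>A'\<close> acts on the first factor, whereas in \<open>\<Phi> B \<otimes> A'\<close> it acts on the
  second factor, so the first factor of \<open>S\<close> corresponds to the second factor of \<open>\<Omega>\<close>.
  Accordingly, the vectors \<open>w\<close> with \<open>S = \<Sum> |w\<rangle>\<langle>w|\<close> arise when \<open>id \<otimes> K\<close>
  is applied to \<open>tensor_flip t \<Omega>\<close>. For \<open>\<Omega> = \<Sum>\<^sub>\<xi> sqrt t\<^sub>\<xi> (\<xi> \<otimes> \<xi>)\<close> the flip leaves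
  \<open>\<Omega>\<close> unchanged.\<close>

definition is_choi_state ::
  "('a::chilbert \<Rightarrow> 'a \<Rightarrow> 'c::chilbert) \<Rightarrow> ('a \<Rightarrow> 'b::chilbert \<Rightarrow> 'd::chilbert) \<Rightarrow>
   'c \<Rightarrow> (('b \<Rightarrow> 'b) \<Rightarrow> 'a \<Rightarrow> 'a) \<Rightarrow> ('d \<Rightarrow> 'd) \<Rightarrow> bool"
  where "is_choi_state t t' \<Omega> \<Phi> S \<longleftrightarrow> S \<in> states \<and>
    (\<forall>A' B. bounded_clinear A' \<longrightarrow> bounded_clinear B \<longrightarrow>
      op_trace (S \<circ> tensor_op t' t' A' B) = cinner \<Omega> (tensor_op t t (\<Phi> B) A' \<Omega>))"

definition kraus ::
  "(('b::chilbert \<Rightarrow> 'b) \<Rightarrow> 'a::chilbert \<Rightarrow> 'a) \<Rightarrow> 'l set \<Rightarrow> ('l \<Rightarrow> 'a \<Rightarrow> 'b) \<Rightarrow> bool"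
  where "kraus \<Phi> L K \<longleftrightarrow> L \<noteq> {} \<and> (\<forall>l\<in>L. bounded_clinear (K l)) \<and>
    (\<forall>B. bounded_clinear B \<longrightarrow> (\<forall>\<phi> \<psi>.
      ((\<lambda>l. cinner \<phi> ((adj (K l) \<circ> B \<circ> K l) \<psi>)) has_sum cinner \<phi> (\<Phi> B \<psi>)) L))"

definition weakly_independent :: "'l set \<Rightarrow> ('l \<Rightarrow> 'a::chilbert \<Rightarrow> 'b::chilbert) \<Rightarrow> bool"
  where "weakly_independent L K \<longleftrightarrow>
    (\<forall>\<alpha>::'l \<Rightarrow> complex. (\<lambda>l. (cmod (\<alpha> l))\<^sup>2) summable_on L \<longrightarrow>
      (\<forall>\<phi> \<psi>. ((\<lambda>l. \<alpha> l * cinner \<psi> (K l \<phi>)) has_sum 0) L) \<longrightarrow> (\<forall>l\<in>L. \<alpha> l = 0))"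

definition minimal_kraus ::
  "(('b::chilbert \<Rightarrow> 'b) \<Rightarrow> 'a::chilbert \<Rightarrow> 'a) \<Rightarrow> 'l set \<Rightarrow> ('l \<Rightarrow> 'a \<Rightarrow> 'b) \<Rightarrow> bool"
  where "minimal_kraus \<Phi> L K \<longleftrightarrow> kraus \<Phi> L K \<and> weakly_independent L K"

text \<open>\<open>S = \<Sum>\<^sub>l |w\<^sub>l\<rangle>\<langle>w\<^sub>l|\<close> with pairwise orthogonal terms; the sum converges pointwise
  (strongly), which is equivalent to weak convergence because the terms are positive.\<close>

definition orthogonal_decomposition ::
  "('d::chilbert \<Rightarrow> 'd) \<Rightarrow> 'l set \<Rightarrow> ('l \<Rightarrow> 'd) \<Rightarrow> bool"
  where "orthogonal_decomposition S L w \<longleftrightarrow>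
    (\<forall>l\<in>L. \<forall>l'\<in>L. l \<noteq> l' \<longrightarrow> cinner (w l) (w l') = 0) \<and>
    (\<forall>x. ((\<lambda>l. cinner (w l) x *\<^sub>C w l) has_sum S x) L)"

end

(* The vector u = \<Omega> with its two factors exchanged is described by its slices u_x, the partial
   inner products with x in the first factor. Kraus operators act on slices: the slices of
   (1 \<otimes> K) u are K u_x. Expanding u over an orthonormal basis of the first factor turns
   the Kraus expansion of \<Phi> into
     sum_l <(1 \<otimes> K_l) u | (A \<otimes> B) (1 \<otimes> K_l) u> = <u | (A \<otimes> \<Phi>(B)) u>,
   which identifies the Choi state in part (a). Conversely, evaluating the Choi state of
   S = sum_l |w_l><w_l| on |x><y| \<otimes> B gives
     sum_l <(w_l)_x | B (w_l)_y> = <u_x | \<Phi>(B) u_y>.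
   For B = 1 this makes K_l u_x = (w_l)_x a well defined contraction on the slices of u, which are
   dense because \<rho>_0 is faithful; for general B it is the Kraus expansion of \<Phi>. Weak
   independence follows because a relation between the K_l is a relation between the orthogonal
   non-zero vectors w_l. *)

theory Submission
  imports Defs
begin

section \<open>Inner products and bounded operators\<close>

text \<open>The condition on tr[\<rho>_0 adj(K_l) K_l'] and the orthogonality of the w_l are one
  statement: by the GNS identity this trace is <w_l|w_l'>. The rest is analysis of unconditional
  sums over arbitrary index sets. Its recurring obstacle is the exchange of a sum over a basis with
  a sum over l. Each exchange rests on domination by squared norms or squared moduli, whose sums are
  known from Parseval, from \<Phi>(1) = 1 or from the trace of S. In part (b) identities are at
  first known only on the slices of u, and the value of an infinite sum does not by itself survive a
  limit. Bounds on finite partial sums do, and they make the Kraus series a bounded form, which is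
  determined on a dense set. Since \<open>adj\<close>, \<open>tensor_op\<close> and
  \<open>tensor_flip\<close> are definite descriptions, existence has to be proved as well; it comes
  from orthogonal series, through the Riesz representation for \<open>adj\<close> and through the
  expansion of a tensor into slices for the other two.\<close>

lemma cinner_add_left: "cinner (x + y) z = cinner x z + cinner y (z::'a::chilbert)"
  by (metis cinner_commute cinner_add_right complex_cnj_add)

lemma cinner_scaleC_left: "cinner (c *\<^sub>C x) y = cnj c * cinner x (y::'a::chilbert)"
  by (metis cinner_commute cinner_scaleC_right complex_cnj_mult)

lemma norm_scaleC: "norm (c *\<^sub>C x) = cmod c * norm (x::'a::chilbert)"
proof -
  have "complex_of_real ((norm (c *\<^sub>C x))\<^sup>2) = cnj c * c * complex_of_real ((norm x)\<^sup>2)"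
    by (simp only: cinner_self[symmetric] cinner_scaleC_left cinner_scaleC_right mult.assoc mult.left_commute)
  also have "\<dots> = complex_of_real ((cmod c * norm x)\<^sup>2)"
    by (simp add: power_mult_distrib complex_norm_square[of c, unfolded of_real_power] mult.commute)
  finally have "(norm (c *\<^sub>C x))\<^sup>2 = (cmod c * norm x)\<^sup>2"
    using of_real_eq_iff by blast
  then show ?thesis
    by (simp add: power2_eq_iff_nonneg)
qed

lemma scaleC_zero_right [simp]: "c *\<^sub>C 0 = (0::'a::chilbert)"
  by (metis norm_scaleC mult_zero_right norm_zero norm_eq_zero)

lemma scaleC_zero_left [simp]: "0 *\<^sub>C x = (0::'a::chilbert)"
  by (metis norm_scaleC mult_zero_left norm_zero norm_eq_zero)

lemma scaleC_minus_one: "(-1) *\<^sub>C x = - (x::'a::chilbert)"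
  using scaleC_add_left[of "-1" 1 x] by (simp add: scaleC_one eq_neg_iff_add_eq_0)

lemma norm_add_sq:
  "(norm (x + y))\<^sup>2 = (norm x)\<^sup>2 + (norm y)\<^sup>2 + 2 * Re (cinner x (y::'a::chilbert))"
proof -
  have "complex_of_real ((norm (x + y))\<^sup>2) = cinner (x + y) (x + y)"
    by (simp only: cinner_self)
  also have "\<dots> = complex_of_real ((norm x)\<^sup>2 + (norm y)\<^sup>2) + (cinner x y + cnj (cinner x y))"
    using cinner_commute[of y x]
    by (simp add: cinner_add_left cinner_add_right cinner_self[of x] cinner_self[of y])
  also have "\<dots> = complex_of_real ((norm x)\<^sup>2 + (norm y)\<^sup>2 + 2 * Re (cinner x y))"
    by (simp add: complex_add_cnj)
  finally show ?thesis
    using of_real_eq_iff by blast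
qed

lemma Cauchy_Schwarz: "cmod (cinner x y) \<le> norm x * norm (y::'a::chilbert)"
proof (cases "x = 0")
  case True
  have "cinner 0 y = 0"
    using cinner_scaleC_left[of 0 0 y] by simp
  then show ?thesis
    by (simp add: True)
next
  case False
  \<comment> \<open>This coefficient makes y + c x orthogonal to x, so the squared norm below is
    that of y minus that of its component along x.\<close>
  define c where "c = - cinner x y / of_real ((norm x)\<^sup>2)"
  have nz: "(norm x)\<^sup>2 \<noteq> 0"
    using False by simp
  have "0 \<le> (norm (y + c *\<^sub>C x))\<^sup>2"
    by simp
  also have "\<dots> = (norm y)\<^sup>2 + (cmod c * norm x)\<^sup>2 + 2 * Re (c * cnj (cinner x y))"
    using cinner_commute[of y x] by (simp add: norm_add_sq norm_scaleC cinner_scaleC_right)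
  also have "c * cnj (cinner x y) = - of_real ((cmod (cinner x y))\<^sup>2 / (norm x)\<^sup>2)"
    unfolding c_def using complex_norm_square[of "cinner x y"] by simp
  also have "cmod c = cmod (cinner x y) / (norm x)\<^sup>2"
    by (simp add: c_def norm_divide norm_power)
  also have "(norm y)\<^sup>2 + (cmod (cinner x y) / (norm x)\<^sup>2 * norm x)\<^sup>2 +
      2 * Re (- complex_of_real ((cmod (cinner x y))\<^sup>2 / (norm x)\<^sup>2)) =
      (norm y)\<^sup>2 - (cmod (cinner x y))\<^sup>2 / (norm x)\<^sup>2"
    using nz by (simp add: field_simps power2_eq_square)
  finally have "(cmod (cinner x y))\<^sup>2 \<le> (norm x * norm y)\<^sup>2"
    using nz by (simp add: field_simps power_mult_distrib)
  then show ?thesis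
    by (rule power2_le_imp_le) simp
qed

lemma bounded_bilinear_cinner: "bounded_bilinear (cinner :: 'a::chilbert \<Rightarrow> 'a \<Rightarrow> complex)"
proof
  fix a a' b b' :: 'a and r :: real
  show "cinner (a + a') b = cinner a b + cinner a' b"
    by (rule cinner_add_left)
  show "cinner a (b + b') = cinner a b + cinner a b'"
    by (rule cinner_add_right)
  show "cinner (r *\<^sub>R a) b = r *\<^sub>R cinner a b" "cinner a (r *\<^sub>R b) = r *\<^sub>R cinner a b"
    by (simp_all add: scaleR_scaleC[of _ a] scaleR_scaleC[of _ b] cinner_scaleC_left
        cinner_scaleC_right scaleR_conv_of_real)
  show "\<exists>K. \<forall>a b::'a. norm (cinner a b) \<le> norm a * norm b * K"
    by (intro exI[of _ 1]) (simp add: Cauchy_Schwarz)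
qed

interpretation cinner: bounded_bilinear cinner
  by (rule bounded_bilinear_cinner)

section \<open>Bounded complex-linear maps\<close>

lemma bounded_clinearI:
  assumes "\<And>x y. A (x + y) = A x + A y" "\<And>c x. A (c *\<^sub>C x) = c *\<^sub>C A x"
    and "\<And>x. norm (A x) \<le> M * norm x"
  shows "bounded_clinear A"
  using assms unfolding bounded_clinear_def by (auto simp: Vector_Spaces.linear_iff vector_space_scaleC)

lemma bounded_clinear_add: "bounded_clinear A \<Longrightarrow> A (x + y) = A x + A y"
  and bounded_clinear_scaleC: "bounded_clinear A \<Longrightarrow> A (c *\<^sub>C x) = c *\<^sub>C A x"
  by (auto simp: bounded_clinear_def Vector_Spaces.linear_iff)

text \<open>The definition admits a negative bound, which occurs only on the zero space; the
  absolute value removes this case.\<close>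

lemma bounded_clinear_bound:
  assumes "bounded_clinear A"
  obtains M where "M \<ge> 0" "\<And>x. norm (A x) \<le> M * norm x"
proof -
  obtain M where M: "\<And>x. norm (A x) \<le> M * norm x"
    using assms by (auto simp: bounded_clinear_def)
  have "norm (A x) \<le> \<bar>M\<bar> * norm x" for x
    using order_trans[OF M[of x] mult_right_mono[of M "\<bar>M\<bar>" "norm x"]] by simp
  then show ?thesis
    using that[of "\<bar>M\<bar>"] by simp
qed

lemma bounded_clinear_bounded_linear: "bounded_clinear A \<Longrightarrow> bounded_linear A"
proof -
  assume A: "bounded_clinear A"
  then obtain M where "\<And>x. norm (A x) \<le> M * norm x"
    using bounded_clinear_bound by blast
  with A show ?thesis
    by (intro bounded_linear_intro[where K = M])
      (simp_all add: bounded_clinear_add bounded_clinear_scaleC scaleR_scaleC mult.commute)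
qed

lemma bounded_clinear_zero: "bounded_clinear A \<Longrightarrow> A 0 = 0"
  using bounded_clinear_scaleC[of A 0 0] by simp

lemma bounded_clinear_continuous: "bounded_clinear A \<Longrightarrow> continuous_on S A"
  using bounded_clinear_bounded_linear linear_continuous_on by blast

lemma bounded_clinear_id: "bounded_clinear id"
  by (rule bounded_clinearI[where M = 1]) auto

lemma bounded_clinear_scale: "bounded_clinear ((*\<^sub>C) c)"
  by (rule bounded_clinearI[where M = "cmod c"])
    (simp_all add: scaleC_add_right scaleC_scaleC mult.commute norm_scaleC)

lemmas bounded_linear_scaleC = bounded_clinear_scale[THEN bounded_clinear_bounded_linear]

lemma bounded_clinear_compose:
  assumes "bounded_clinear A" "bounded_clinear B"
  shows "bounded_clinear (\<lambda>x. A (B x))"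
proof -
  obtain M where M: "M \<ge> 0" "\<And>x. norm (A x) \<le> M * norm x"
    using bounded_clinear_bound[OF assms(1)] by blast
  obtain N where N: "N \<ge> 0" "\<And>x. norm (B x) \<le> N * norm x"
    using bounded_clinear_bound[OF assms(2)] by blast
  have "norm (A (B x)) \<le> (M * N) * norm x" for x
    using M(2)[of "B x"] mult_left_mono[OF N(2)[of x] M(1)] by (simp add: mult.assoc)
  then show ?thesis
    using assms by (intro bounded_clinearI[where M = "M * N"])
      (simp_all add: bounded_clinear_add bounded_clinear_scaleC)
qed

lemma bounded_clinear_comp:
  "bounded_clinear A \<Longrightarrow> bounded_clinear B \<Longrightarrow> bounded_clinear (A \<circ> B)"
  unfolding comp_def by (rule bounded_clinear_compose)

text \<open>The operator |a><b|. Traces against such operators are matrix elements, which is how a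
  state is recovered from its Choi identity.\<close>

definition rank_one :: "'b::chilbert \<Rightarrow> 'a::chilbert \<Rightarrow> 'a \<Rightarrow> 'b"
  where "rank_one a b = (\<lambda>x. cinner b x *\<^sub>C a)"

lemma bounded_clinear_rank_one: "bounded_clinear (rank_one a b)"
proof (rule bounded_clinearI[where M = "norm b * norm a"])
  show "norm (rank_one a b x) \<le> norm b * norm a * norm x" for x
    using mult_right_mono[OF Cauchy_Schwarz[of b x], of "norm a"]
    by (simp add: rank_one_def norm_scaleC mult_ac)
qed (simp_all add: rank_one_def cinner_add_right scaleC_add_left cinner_scaleC_right scaleC_scaleC)

section \<open>Complex subspaces and density\<close>

definition complex_subspace :: "'a::chilbert set \<Rightarrow> bool"
  where "complex_subspace M \<longleftrightarrow> 0 \<in> M \<and> (\<forall>x\<in>M. \<forall>y\<in>M. x + y \<in> M) \<and> (\<forall>c. \<forall>x\<in>M. c *\<^sub>C x \<in> M)"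

lemma module_scaleC: "module (scaleC :: complex \<Rightarrow> 'a \<Rightarrow> 'a::chilbert)"
  by standard (simp_all add: scaleC_add_right scaleC_add_left scaleC_scaleC scaleC_one)

lemma complex_subspace_iff: "complex_subspace M \<longleftrightarrow> module.subspace scaleC M"
  by (auto simp: complex_subspace_def module.subspace_def[OF module_scaleC])

lemma complex_subspace_cspan: "complex_subspace (cspan A)"
  unfolding complex_subspace_iff cspan_def by (rule module.subspace_span[OF module_scaleC])

lemma subset_cspan: "A \<subseteq> cspan A"
  unfolding cspan_def by (rule module.span_superset[OF module_scaleC])

lemma cspan_minimal: "A \<subseteq> M \<Longrightarrow> complex_subspace M \<Longrightarrow> cspan A \<subseteq> M"
  unfolding cspan_def complex_subspace_iff by (rule module.span_minimal[OF module_scaleC])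

lemma complex_subspace_diff: "complex_subspace M \<Longrightarrow> x \<in> M \<Longrightarrow> y \<in> M \<Longrightarrow> x - y \<in> M"
  unfolding complex_subspace_def
  by (metis scaleC_minus_one add_uminus_conv_diff)

lemma complex_subspace_sum:
  "complex_subspace M \<Longrightarrow> (\<And>i. i \<in> F \<Longrightarrow> f i \<in> M) \<Longrightarrow> sum f F \<in> M"
  by (induction F rule: infinite_finite_induct) (auto simp: complex_subspace_def)

lemma complex_subspace_closure:
  assumes "complex_subspace M"
  shows "complex_subspace (closure M)"
proof -
  have "x + y \<in> closure M" if xy: "x \<in> closure M" "y \<in> closure M" for x y
  proof -
    obtain u v where uv: "\<And>n. u n \<in> M" "u \<longlonglongrightarrow> x" "\<And>n. v n \<in> M" "v \<longlonglongrightarrow> y"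
      using xy unfolding closure_sequential by blast
    then have "(\<lambda>n. u n + v n) \<longlonglongrightarrow> x + y" "\<And>n. u n + v n \<in> M"
      using assms by (auto simp: complex_subspace_def intro: tendsto_add)
    then show ?thesis
      unfolding closure_sequential by (intro exI[of _ "\<lambda>n. u n + v n"]) blast
  qed
  moreover have "c *\<^sub>C x \<in> closure M" if x: "x \<in> closure M" for c x
  proof -
    obtain u where u: "\<And>n. u n \<in> M" "u \<longlonglongrightarrow> x"
      using x unfolding closure_sequential by blast
    from bounded_linear.tendsto[OF bounded_linear_scaleC u(2)]
    have "(\<lambda>n. c *\<^sub>C u n) \<longlonglongrightarrow> c *\<^sub>C x" .
    moreover have "c *\<^sub>C u n \<in> M" for n
      using assms u(1) by (auto simp: complex_subspace_def)
    ultimately show ?thesis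
      unfolding closure_sequential by (intro exI[of _ "\<lambda>n. c *\<^sub>C u n"]) blast
  qed
  moreover have "0 \<in> closure M"
    using assms closure_subset by (auto simp: complex_subspace_def)
  ultimately show ?thesis
    by (simp add: complex_subspace_def)
qed

lemma bounded_clinear_eqI:
  assumes "bounded_clinear A" "bounded_clinear B" "closure (cspan X) = UNIV"
    and "\<And>x. x \<in> X \<Longrightarrow> A x = B x"
  shows "A = B"
proof -
  have "closed {x. A x = B x}"
    by (intro closed_Collect_eq bounded_clinear_continuous assms(1,2))
  moreover have "cspan X \<subseteq> {x. A x = B x}"
    using assms(4)
    by (intro cspan_minimal) (auto simp: complex_subspace_def assms(1,2) bounded_clinear_add
        bounded_clinear_scaleC bounded_clinear_zero)
  ultimately show ?thesis
    using closure_minimal assms(3) by blast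
qed

lemma eq_zero_if_cinner_zero:
  assumes "closure (cspan X) = UNIV" and "\<And>x. x \<in> X \<Longrightarrow> cinner x z = 0"
  shows "z = 0"
proof -
  have "closed {x. cinner x z = 0}"
    by (intro closed_Collect_eq continuous_intros cinner.continuous_on)
  moreover have "cspan X \<subseteq> {x. cinner x z = 0}"
    using assms(2)
    by (intro cspan_minimal) (auto simp: complex_subspace_def cinner_add_left cinner_scaleC_left cinner.zero_left)
  ultimately have "cinner z z = 0"
    using closure_minimal assms(1) by blast
  then show ?thesis
    by (simp add: cinner_self)
qed

lemma cinner_ext: "(\<And>x. cinner x y = cinner x z) \<Longrightarrow> y = (z::'a::chilbert)"
  using cinner_self[of "y - z"] by (simp add: cinner.diff_right)

text \<open>Bounded functions on a dense set are represented here by a parametrisation \<open>R\<close> of that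
  set, which need not be linear.\<close>

lemma dense_extension:
  fixes R :: "'x \<Rightarrow> 'a::chilbert" and W :: "'x \<Rightarrow> 'b::chilbert"
  assumes dense: "closure (range R) = UNIV"
    and sum: "\<And>x y. \<exists>z. R z = R x + R y \<and> W z = W x + W y"
    and scale: "\<And>c x. \<exists>z. R z = c *\<^sub>C R x \<and> W z = c *\<^sub>C W x"
    and bound: "\<And>x. norm (W x) \<le> M * norm (R x)"
  obtains K where "bounded_clinear K" "\<And>x. K (R x) = W x"
proof -
  \<comment> \<open>Differences of values are attained at a common parameter, so the bound applies
    to them. In particular W x depends only on R x, which makes the \<open>SOME\<close> in
    \<open>f\<close> harmless.\<close>
  have diff: "norm (W x - W y) \<le> M * norm (R x - R y)" for x y
  proof -
    obtain y' where y': "R y' = (-1) *\<^sub>C R y" "W y' = (-1) *\<^sub>C W y"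
      using scale by blast
    obtain z where "R z = R x + R y'" "W z = W x + W y'"
      using sum by blast
    then show ?thesis
      using y' bound[of z] by (simp add: scaleC_minus_one)
  qed
  define f where "f = (\<lambda>y. W (SOME x. R x = y))"
  have fR: "f (R x) = W x" for x
  proof -
    have "R (SOME x'. R x' = R x) = R x"
      by (rule someI) simp
    then show ?thesis
      using diff[of "SOME x'. R x' = R x" x] by (simp add: f_def)
  qed
  have "norm (W x - W y) \<le> \<bar>M\<bar> * norm (R x - R y)" for x y
    using order_trans[OF diff[of x y] mult_right_mono[of M "\<bar>M\<bar>"]] by simp
  then have "\<bar>M\<bar>-lipschitz_on (range R) f"
    by (intro lipschitz_onI) (auto simp: fR dist_norm)
  then have uc: "uniformly_continuous_on (range R) f"
    by (rule lipschitz_on_uniformly_continuous)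
  obtain K where uK: "uniformly_continuous_on (closure (range R)) K"
    and "\<And>y. y \<in> range R \<Longrightarrow> f y = K y"
    using uniformly_continuous_on_extension_on_closure[OF uc] by metis
  then have KR: "K (R x) = W x" for x
    using fR[of x] by auto
  have cK: "continuous_on UNIV K"
    using uK dense uniformly_continuous_imp_continuous by metis
  have cK': "isCont K x" for x
    using cK by (simp add: continuous_on_eq_continuous_at)
  have seq: "\<exists>u. (\<lambda>n::nat. R (u n)) \<longlonglongrightarrow> x" for x
  proof -
    have "x \<in> closure (range R)"
      using dense by simp
    then obtain v where v: "\<And>n::nat. v n \<in> range R" "v \<longlonglongrightarrow> x"
      unfolding closure_sequential by blast
    have "v = (\<lambda>n. R (inv R (v n)))"
      using v(1) by (simp add: f_inv_into_f)
    then show ?thesis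
      using v(2) by (intro exI[of _ "\<lambda>n. inv R (v n)"]) simp
  qed
  have lim: "(\<lambda>n. W (u n)) \<longlonglongrightarrow> K x" if "(\<lambda>n::nat. R (u n)) \<longlonglongrightarrow> x" for u x
    using isCont_tendsto_compose[OF cK' that] by (simp add: KR)
  have "K (x + y) = K x + K y" for x y
  proof -
    obtain u v where uv: "(\<lambda>n::nat. R (u n)) \<longlonglongrightarrow> x" "(\<lambda>n::nat. R (v n)) \<longlonglongrightarrow> y"
      using seq by blast
    \<comment> \<open>The limit is known only along sequences of values of R, so a parameter is
      chosen for each sum of approximants.\<close>
    have "\<forall>n. \<exists>z. R z = R (u n) + R (v n) \<and> W z = W (u n) + W (v n)"
      using sum by blast
    from choice[OF this] obtain z
      where "\<forall>n. R (z n) = R (u n) + R (v n) \<and> W (z n) = W (u n) + W (v n)"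
      by (rule exE)
    then have z: "\<And>n. R (z n) = R (u n) + R (v n)" "\<And>n. W (z n) = W (u n) + W (v n)"
      by auto
    have "(\<lambda>n. R (z n)) \<longlonglongrightarrow> x + y" "(\<lambda>n. W (z n)) \<longlonglongrightarrow> K x + K y"
      unfolding z by (intro tendsto_add uv lim[OF uv(1)] lim[OF uv(2)])+
    then show ?thesis
      using lim[of z] LIMSEQ_unique by blast
  qed
  moreover have "K (c *\<^sub>C x) = c *\<^sub>C K x" for c x
  proof -
    obtain u where u: "(\<lambda>n::nat. R (u n)) \<longlonglongrightarrow> x"
      using seq by blast
    have "\<forall>n. \<exists>z. R z = c *\<^sub>C R (u n) \<and> W z = c *\<^sub>C W (u n)"
      using scale by blast
    from choice[OF this] obtain z
      where "\<forall>n. R (z n) = c *\<^sub>C R (u n) \<and> W (z n) = c *\<^sub>C W (u n)"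
      by (rule exE)
    then have z: "\<And>n. R (z n) = c *\<^sub>C R (u n)" "\<And>n. W (z n) = c *\<^sub>C W (u n)"
      by auto
    have "(\<lambda>n. R (z n)) \<longlonglongrightarrow> c *\<^sub>C x" "(\<lambda>n. W (z n)) \<longlonglongrightarrow> c *\<^sub>C K x"
      unfolding z by (intro bounded_linear.tendsto[OF bounded_linear_scaleC] u lim[OF u])+
    then show ?thesis
      using lim[of z] LIMSEQ_unique by blast
  qed
  moreover have "norm (K x) \<le> M * norm x" for x
  proof -
    obtain u where u: "(\<lambda>n::nat. R (u n)) \<longlonglongrightarrow> x"
      using seq by blast
    show ?thesis
      by (rule LIMSEQ_le[OF tendsto_norm[OF lim[OF u]] tendsto_mult_left[OF tendsto_norm[OF u]]])
        (use bound in blast)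
  qed
  ultimately have "bounded_clinear K"
    by (intro bounded_clinearI[where M = M])
  then show ?thesis
    using that KR by blast
qed

section \<open>Orthogonal expansions\<close>

lemma norm_sum_orthogonal:
  fixes f :: "'i \<Rightarrow> 'a::chilbert"
  assumes "finite F" and "\<And>i j. i \<in> F \<Longrightarrow> j \<in> F \<Longrightarrow> i \<noteq> j \<Longrightarrow> cinner (f i) (f j) = 0"
  shows "(norm (sum f F))\<^sup>2 = (\<Sum>i\<in>F. (norm (f i))\<^sup>2)"
  using assms
proof (induction F)
  case (insert i F)
  have "cinner (f i) (sum f F) = (\<Sum>j\<in>F. cinner (f i) (f j))"
    by (rule cinner.sum_right)
  also have "\<dots> = 0"
    using insert.hyps insert.prems by (intro sum.neutral) auto
  finally show ?case
    using insert by (simp add: norm_add_sq)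
qed simp

text \<open>Such a family need not be absolutely summable. By Pythagoras the squared distance of two
  nested partial sums is a piece of the series of squared norms, so the net of finite partial sums
  is Cauchy.\<close>

lemma orthogonal_summable_on:
  fixes f :: "'i \<Rightarrow> 'a::chilbert"
  assumes orth: "\<And>i j. i \<in> A \<Longrightarrow> j \<in> A \<Longrightarrow> i \<noteq> j \<Longrightarrow> cinner (f i) (f j) = 0"
    and summable: "(\<lambda>i. (norm (f i))\<^sup>2) summable_on A"
  shows "f summable_on A"
proof -
  let ?q = "\<lambda>i. (norm (f i))\<^sup>2"
  have "\<exists>P. eventually P (finite_subsets_at_top A) \<and>
      (\<forall>F F'. P F \<and> P F' \<longrightarrow> dist (sum f F) (sum f F') < e)" if "e > 0" for e
  proof -
    have "(e/2)\<^sup>2 > 0"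
      using that by simp
    \<comment> \<open>Two partial sums are compared through \<open>F\<^sub>0\<close>, hence e/2;
      halving the square once more turns a weak inequality into the strict one wanted.\<close>
    then obtain F\<^sub>0 where F\<^sub>0: "finite F\<^sub>0" "F\<^sub>0 \<subseteq> A" "dist (sum ?q F\<^sub>0) (infsum ?q A) \<le> (e/2)\<^sup>2 / 2"
      using infsum_finite_approximation[OF summable, of "(e/2)\<^sup>2 / 2"] by auto
    define P where "P F \<longleftrightarrow> finite F \<and> F\<^sub>0 \<subseteq> F \<and> F \<subseteq> A" for F
    have near: "dist (sum f F) (sum f F\<^sub>0) < e/2" if "P F" for F
    proof -
      have F: "finite F" "F\<^sub>0 \<subseteq> F" "F \<subseteq> A"
        using that by (auto simp: P_def)
      have "(dist (sum f F) (sum f F\<^sub>0))\<^sup>2 = (norm (sum f (F - F\<^sub>0)))\<^sup>2"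
        using F by (simp add: dist_norm sum_diff)
      also have "\<dots> = sum ?q (F - F\<^sub>0)"
        using F by (intro norm_sum_orthogonal orth) auto
      also have "\<dots> = sum ?q F - sum ?q F\<^sub>0"
        using F by (simp add: sum_diff)
      also have "\<dots> \<le> infsum ?q A - sum ?q F\<^sub>0"
        using finite_sum_le_infsum[OF summable F(1,3)] by simp
      also have "\<dots> \<le> (e/2)\<^sup>2 / 2"
        using F\<^sub>0(3) unfolding dist_real_def by linarith
      also have "\<dots> < (e/2)\<^sup>2"
        using \<open>(e/2)\<^sup>2 > 0\<close> by simp
      finally show ?thesis
        using \<open>e > 0\<close> by (intro power_less_imp_less_base[of _ 2 "e/2"]) auto
    qed
    have "eventually P (finite_subsets_at_top A)"
      using F\<^sub>0(1,2) unfolding eventually_finite_subsets_at_top P_def by blast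
    moreover have "dist (sum f F) (sum f F') < e" if "P F" "P F'" for F F'
      using near[OF that(1)] near[OF that(2)] by (rule dist_triangle_half_l)
    ultimately show ?thesis
      by blast
  qed
  then have "cauchy_filter (filtermap (sum f) (finite_subsets_at_top A))"
    by (simp add: cauchy_filter_metric_filtermap)
  moreover have "complete (UNIV::'a set)"
    by (meson Cauchy_convergent UNIV_I complete_def convergent_def)
  ultimately obtain s where "(sum f \<longlongrightarrow> s) (finite_subsets_at_top A)"
    using complete_uniform[where S=UNIV] by (force simp add: filterlim_def)
  then show ?thesis
    using summable_on_def has_sum_def by blast
qed

lemma orthogonal_has_sum_norm_sq:
  fixes f :: "'i \<Rightarrow> 'a::chilbert"
  assumes orth: "\<And>i j. i \<in> A \<Longrightarrow> j \<in> A \<Longrightarrow> i \<noteq> j \<Longrightarrow> cinner (f i) (f j) = 0"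
    and "(f has_sum s) A"
  shows "((\<lambda>i. (norm (f i))\<^sup>2) has_sum (norm s)\<^sup>2) A"
proof -
  have "((\<lambda>F. (norm (sum f F))\<^sup>2) \<longlongrightarrow> (norm s)\<^sup>2) (finite_subsets_at_top A)"
    using assms(2) unfolding has_sum_def by (intro tendsto_intros)
  then show ?thesis
    unfolding has_sum_def
  proof (rule Lim_transform_eventually)
    show "\<forall>\<^sub>F F in finite_subsets_at_top A. (norm (sum f F))\<^sup>2 = (\<Sum>i\<in>F. (norm (f i))\<^sup>2)"
      by (intro eventually_finite_subsets_at_top_weakI norm_sum_orthogonal orth) auto
  qed
qed

lemma has_sum_in_closed_subspace:
  assumes "closed M" "complex_subspace M" "\<And>i. i \<in> A \<Longrightarrow> f i \<in> M" "(f has_sum s) A"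
  shows "s \<in> M"
proof (rule Lim_in_closed_set[OF assms(1)])
  show "(sum f \<longlongrightarrow> s) (finite_subsets_at_top A)"
    using assms(4) by (simp add: has_sum_def)
  show "\<forall>\<^sub>F F in finite_subsets_at_top A. sum f F \<in> M"
    using assms(2,3) by (intro eventually_finite_subsets_at_top_weakI complex_subspace_sum) auto
qed simp

text \<open>\<open>is_onb\<close> without the density clause, since Zorn's lemma is applied to
  orthonormal sets inside a subspace.\<close>

definition orthonormal :: "'a::chilbert set \<Rightarrow> bool"
  where "orthonormal E \<longleftrightarrow> (\<forall>e\<in>E. norm e = 1) \<and> (\<forall>e\<in>E. \<forall>f\<in>E. e \<noteq> f \<longrightarrow> cinner e f = 0)"

lemma is_onb_iff: "is_onb E \<longleftrightarrow> orthonormal E \<and> closure (cspan E) = UNIV"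
  by (simp add: is_onb_def orthonormal_def)

text \<open>Bessel's inequality. The second hypothesis says that \<open>f i\<close> is the component of \<open>x\<close>
  in the direction of \<open>f i\<close>.\<close>

lemma orthogonal_components_bound:
  fixes f :: "'i \<Rightarrow> 'a::chilbert"
  assumes "\<And>i j. i \<in> F \<Longrightarrow> j \<in> F \<Longrightarrow> i \<noteq> j \<Longrightarrow> cinner (f i) (f j) = 0"
    and "\<And>i. i \<in> F \<Longrightarrow> cinner x (f i) = cinner (f i) (f i)" and "finite F"
  shows "(\<Sum>i\<in>F. (norm (f i))\<^sup>2) \<le> (norm x)\<^sup>2"
proof -
  define p where "p = sum f F"
  define q where "q = (\<Sum>i\<in>F. (norm (f i))\<^sup>2)"
  have "(norm p)\<^sup>2 = q"
    unfolding p_def q_def using assms by (intro norm_sum_orthogonal) auto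
  moreover have "cinner x p = of_real q"
    by (simp add: p_def q_def cinner.sum_right assms(2) cinner_self)
  moreover have "(norm (x + (-1) *\<^sub>C p))\<^sup>2 = (norm x)\<^sup>2 + (norm p)\<^sup>2 - 2 * Re (cinner x p)"
    by (simp add: norm_add_sq norm_scaleC cinner_scaleC_right)
  ultimately show ?thesis
    using zero_le_power2[of "norm (x + (-1) *\<^sub>C p)"] by (simp add: q_def)
qed

text \<open>Serves two expansions: coordinates along an orthonormal set, and the components
  \<open>t e (adj (t e) u)\<close> of a tensor.\<close>

lemma orthogonal_components_summable_on:
  fixes f :: "'i \<Rightarrow> 'a::chilbert"
  assumes "\<And>i j. i \<in> A \<Longrightarrow> j \<in> A \<Longrightarrow> i \<noteq> j \<Longrightarrow> cinner (f i) (f j) = 0"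
    and "\<And>i. i \<in> A \<Longrightarrow> cinner x (f i) = cinner (f i) (f i)"
  shows "f summable_on A"
proof -
  have "(\<Sum>i\<in>F. (norm (f i))\<^sup>2) \<le> (norm x)\<^sup>2" if "finite F" "F \<subseteq> A" for F
    using that by (intro orthogonal_components_bound assms) auto
  then have "(\<lambda>i. (norm (f i))\<^sup>2) summable_on A"
    by (intro nonneg_bdd_above_summable_on bdd_aboveI2) auto
  with assms(1) show ?thesis
    by (rule orthogonal_summable_on)
qed

text \<open>Here p is the orthogonal projection of x onto the closed span of E. Pairing the series
  with e leaves a single term, so p and x have the same coefficients.\<close>

lemma orthonormal_projection:
  assumes "orthonormal E"
  obtains p where "((\<lambda>e. cinner e x *\<^sub>C e) has_sum p) E" "\<And>e. e \<in> E \<Longrightarrow> cinner e (x - p) = 0"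
proof -
  have E: "\<And>e. e \<in> E \<Longrightarrow> norm e = 1" "\<And>e f. e \<in> E \<Longrightarrow> f \<in> E \<Longrightarrow> e \<noteq> f \<Longrightarrow> cinner e f = 0"
    using assms by (auto simp: orthonormal_def)
  have "cinner x (cinner e x *\<^sub>C e) = cinner (cinner e x *\<^sub>C e) (cinner e x *\<^sub>C e)" if "e \<in> E" for e
    using E(1)[OF that] cinner_commute[of x e]
    by (simp add: cinner_scaleC_left cinner_scaleC_right cinner_self[of e])
  then have "(\<lambda>e. cinner e x *\<^sub>C e) summable_on E"
    by (intro orthogonal_components_summable_on[of E _ x])
      (simp_all add: cinner_scaleC_left cinner_scaleC_right E)
  then obtain p where p: "((\<lambda>e. cinner e x *\<^sub>C e) has_sum p) E"
    by (auto simp: summable_on_def)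
  have "cinner e (x - p) = 0" if "e \<in> E" for e
  proof -
    have "((\<lambda>f. cinner e (cinner f x *\<^sub>C f)) has_sum cinner e p) E"
      by (rule has_sum_bounded_linear[OF cinner.bounded_linear_right p])
    moreover have "((\<lambda>f. cinner e (cinner f x *\<^sub>C f)) has_sum cinner e x) E"
      using that by (intro has_sum_finite_neutralI[of "{e}"])
        (auto simp: cinner_scaleC_right cinner_self[of e] E)
    ultimately show ?thesis
      using has_sum_unique by (fastforce simp: cinner.diff_right)
  qed
  with p show ?thesis
    using that by blast
qed

text \<open>Zorn's lemma gives a maximal orthonormal subset of M. If x in M differed from its
  projection p, the normalised remainder would lie in M, because M is closed, and could be added to
  E.\<close>

lemma closed_subspace_orthonormal_basis:
  assumes "closed M" "complex_subspace M"
  obtains E where "E \<subseteq> M" "orthonormal E" "\<And>x. x \<in> M \<Longrightarrow> ((\<lambda>e. cinner e x *\<^sub>C e) has_sum x) E"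
proof -
  let ?A = "{E. E \<subseteq> M \<and> orthonormal E}"
  have "\<exists>E\<in>?A. \<forall>X\<in>?A. E \<subseteq> X \<longrightarrow> X = E"
  proof (rule subset_Zorn')
    fix C assume C: "subset.chain ?A C"
    have "orthonormal (\<Union>C)"
      unfolding orthonormal_def
    proof (intro conjI ballI impI)
      fix e f assume "e \<in> \<Union>C" "f \<in> \<Union>C" and ef: "e \<noteq> f"
      then obtain X Y where XY: "X \<in> C" "Y \<in> C" "e \<in> X" "f \<in> Y"
        by blast
      then have "X \<subseteq> Y \<or> Y \<subseteq> X"
        using C unfolding subset_chain_def by blast
      then have "\<exists>Z\<in>C. e \<in> Z \<and> f \<in> Z"
        using XY by blast
      then show "cinner e f = 0"
        using C ef unfolding subset_chain_def orthonormal_def by blast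
    qed (use C in \<open>auto simp: subset_chain_def orthonormal_def\<close>)
    then show "\<Union>C \<in> ?A"
      using C unfolding subset_chain_def by blast
  qed
  then obtain E where "E \<in> ?A" "\<forall>X\<in>?A. E \<subseteq> X \<longrightarrow> X = E"
    by (rule bexE)
  then have E: "E \<subseteq> M" "orthonormal E"
    and maximal: "\<And>X. X \<subseteq> M \<Longrightarrow> orthonormal X \<Longrightarrow> E \<subseteq> X \<Longrightarrow> X = E"
    by auto
  have "((\<lambda>e. cinner e x *\<^sub>C e) has_sum x) E" if "x \<in> M" for x
  proof -
    obtain p where p: "((\<lambda>e. cinner e x *\<^sub>C e) has_sum p) E"
      and orth: "\<And>e. e \<in> E \<Longrightarrow> cinner e (x - p) = 0"
      using orthonormal_projection[OF E(2)] by blast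
    have "p \<in> M"
      using assms(2) E(1) by (intro has_sum_in_closed_subspace[OF assms _ p]) (auto simp: complex_subspace_def)
    then have xpM: "x - p \<in> M"
      using that assms(2) by (intro complex_subspace_diff)
    have "x - p = 0"
    proof (rule ccontr)
      assume nz: "x - p \<noteq> 0"
      define y where "y = complex_of_real (inverse (norm (x - p))) *\<^sub>C (x - p)"
      have y1: "norm y = 1"
        using nz by (simp add: y_def norm_scaleC norm_inverse)
      have orthy: "cinner e y = 0" "cinner y e = 0" if "e \<in> E" for e
        using orth[OF that] cinner_commute[of y e] by (simp_all add: y_def cinner_scaleC_right)
      have "y \<in> M"
        using xpM assms(2) by (simp add: y_def complex_subspace_def)
      then have "insert y E = E"
        using y1 E orthy by (intro maximal) (auto simp: orthonormal_def)
      then show False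
        using orthy(1)[of y] y1 by (auto simp: cinner_self)
    qed
    then show ?thesis
      using p by simp
  qed
  then show ?thesis
    using that E by blast
qed

text \<open>Each x is compared with its projection p onto the closure of M: the remainder is
  orthogonal to M and hence zero.\<close>

lemma dense_if_orthogonal_trivial:
  assumes "complex_subspace M" and "\<And>y. (\<And>m. m \<in> M \<Longrightarrow> cinner m y = 0) \<Longrightarrow> y = 0"
  shows "closure M = UNIV"
proof -
  note cl = closed_closure complex_subspace_closure[OF assms(1)]
  obtain E where E: "E \<subseteq> closure M" "orthonormal E"
    "\<And>x. x \<in> closure M \<Longrightarrow> ((\<lambda>e. cinner e x *\<^sub>C e) has_sum x) E"
    using closed_subspace_orthonormal_basis[OF cl] by blast
  have "x \<in> closure M" for x
  proof -
    obtain p where p: "((\<lambda>e. cinner e x *\<^sub>C e) has_sum p) E"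
      and orth: "\<And>e. e \<in> E \<Longrightarrow> cinner e (x - p) = 0"
      using orthonormal_projection[OF E(2)] by blast
    have "p \<in> closure M"
      using cl(2) E(1) by (intro has_sum_in_closed_subspace[OF cl _ p]) (auto simp: complex_subspace_def)
    moreover have "cinner m (x - p) = 0" if "m \<in> M" for m
    proof -
      have "((\<lambda>e. cinner (cinner e m *\<^sub>C e) (x - p)) has_sum cinner m (x - p)) E"
        using that closure_subset E(3) by (intro has_sum_bounded_linear[OF cinner.bounded_linear_left]) blast
      moreover have "((\<lambda>e. cinner (cinner e m *\<^sub>C e) (x - p)) has_sum 0) E"
        by (rule has_sum_0) (simp add: cinner_scaleC_left orth)
      ultimately show ?thesis
        using has_sum_unique by blast
    qed
    then have "x - p = 0"
      using assms(2) by blast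
    ultimately show ?thesis
      by simp
  qed
  then show ?thesis
    by blast
qed

lemma onb_expansion:
  assumes "is_onb E"
  shows "((\<lambda>e. cinner e x *\<^sub>C e) has_sum x) E"
proof -
  obtain p where p: "((\<lambda>e. cinner e x *\<^sub>C e) has_sum p) E"
    and "\<And>e. e \<in> E \<Longrightarrow> cinner e (x - p) = 0"
    using orthonormal_projection assms is_onb_iff by blast
  then have "x - p = 0"
    using assms by (intro eq_zero_if_cinner_zero[of E]) (auto simp: is_onb_iff)
  then show ?thesis
    using p by simp
qed

lemma onb_exists: "\<exists>E::'a::chilbert set. is_onb E"
proof -
  obtain E :: "'a set" where E: "orthonormal E" "\<And>x. ((\<lambda>e. cinner e x *\<^sub>C e) has_sum x) E"
    using closed_subspace_orthonormal_basis[OF closed_UNIV] by (auto simp: complex_subspace_def)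
  have "x \<in> closure (cspan E)" for x :: 'a
  proof (rule has_sum_in_closed_subspace[OF closed_closure complex_subspace_closure[OF complex_subspace_cspan]])
    show "cinner e x *\<^sub>C e \<in> closure (cspan E)" if "e \<in> E" for e
      using that subset_cspan[of E] complex_subspace_cspan[of E]
      by (intro closure_subset[THEN subsetD]) (auto simp: complex_subspace_def)
  qed (rule E)
  then show ?thesis
    using E(1) by (auto simp: is_onb_iff)
qed

text \<open>This is the basis over which \<open>op_trace\<close> sums.\<close>

lemma is_onb_some: "is_onb (SOME E. is_onb E)"
  using onb_exists by (rule someI_ex)

lemma Parseval:
  assumes "is_onb E"
  shows "((\<lambda>e. cinner x e * cinner e y) has_sum cinner x y) E"
  using has_sum_bounded_linear[OF cinner.bounded_linear_right[of x] onb_expansion[OF assms, of y]]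
  by (simp only: cinner_scaleC_right mult.commute[of "cinner x _"])

lemma Parseval_norm:
  assumes "is_onb E"
  shows "((\<lambda>e. (cmod (cinner e x))\<^sup>2) has_sum (norm x)\<^sup>2) E"
proof -
  have "((\<lambda>e. (norm (cinner e x *\<^sub>C e))\<^sup>2) has_sum (norm x)\<^sup>2) E"
  proof (rule orthogonal_has_sum_norm_sq[OF _ onb_expansion[OF assms]])
    show "cinner (cinner e x *\<^sub>C e) (cinner f x *\<^sub>C f) = 0" if "e \<in> E" "f \<in> E" "e \<noteq> f" for e f
      using assms that by (simp add: cinner_scaleC_left cinner_scaleC_right is_onb_def)
  qed
  then show ?thesis
    by (rule has_sum_cong[THEN iffD1, rotated]) (use assms in \<open>simp add: norm_scaleC is_onb_def\<close>)
qed

lemma Riesz_representation: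
  fixes f :: "'a::chilbert \<Rightarrow> complex"
  assumes "bounded_clinear f"
  obtains z where "\<And>x. f x = cinner z x"
proof -
  obtain E :: "'a set" where onb: "is_onb E"
    using onb_exists by blast
  then have E: "\<And>e. e \<in> E \<Longrightarrow> norm e = 1" "\<And>e f. e \<in> E \<Longrightarrow> f \<in> E \<Longrightarrow> e \<noteq> f \<Longrightarrow> cinner e f = 0"
    by (auto simp: is_onb_def)
  obtain M where M: "M \<ge> 0" "\<And>x. norm (f x) \<le> M * norm x"
    using bounded_clinear_bound[OF assms] by blast
  note f = bounded_clinear_bounded_linear[OF assms]
  have f_scale: "f (c *\<^sub>C x) = c * f x" for c x
    using bounded_clinear_scaleC[OF assms] by (simp add: scaleC_complex_def)
  have "(\<Sum>e\<in>F. (cmod (f e))\<^sup>2) \<le> M\<^sup>2" if F: "finite F" "F \<subseteq> E" for F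
  proof -
    \<comment> \<open>The representing vector must have coordinates cnj (f e). On a finite piece v
      of it, f v is the squared norm of v, so boundedness of f gives norm v \<le> M uniformly in
      F.\<close>
    define v where "v = (\<Sum>e\<in>F. cnj (f e) *\<^sub>C e)"
    define q where "q = (\<Sum>e\<in>F. (cmod (f e))\<^sup>2)"
    have "(norm v)\<^sup>2 = (\<Sum>e\<in>F. (norm (cnj (f e) *\<^sub>C e))\<^sup>2)"
      unfolding v_def using F E
      by (intro norm_sum_orthogonal) (auto simp: cinner_scaleC_left cinner_scaleC_right subset_iff)
    also have "\<dots> = q"
      unfolding q_def using F E by (intro sum.cong) (auto simp: norm_scaleC subset_iff)
    finally have norm_v: "(norm v)\<^sup>2 = q" .
    have "f v = (\<Sum>e\<in>F. f (cnj (f e) *\<^sub>C e))"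
      unfolding v_def by (rule linear_sum[OF bounded_linear.linear[OF f]])
    also have "\<dots> = (\<Sum>e\<in>F. of_real ((cmod (f e))\<^sup>2))"
      by (simp only: f_scale complex_norm_square mult.commute)
    finally have "f v = of_real q"
      by (simp add: q_def)
    moreover have "q \<ge> 0"
      by (simp add: q_def sum_nonneg)
    ultimately have "(norm v)\<^sup>2 \<le> M * norm v"
      using M(2)[of v] norm_v by simp
    then have "norm v \<le> M"
      using M(1) by (cases "norm v = 0") (auto simp: power2_eq_square)
    then show ?thesis
      using norm_v power_mono[of "norm v" M 2] by (simp add: q_def)
  qed
  then have "(\<lambda>e. (cmod (f e))\<^sup>2) summable_on E"
    by (intro nonneg_bdd_above_summable_on bdd_aboveI2) auto
  then have "(\<lambda>e. (norm (cnj (f e) *\<^sub>C e))\<^sup>2) summable_on E"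
    by (rule summable_on_cong[THEN iffD1, rotated]) (simp add: norm_scaleC E)
  then have "(\<lambda>e. cnj (f e) *\<^sub>C e) summable_on E"
    by (intro orthogonal_summable_on) (simp_all add: cinner_scaleC_left cinner_scaleC_right E)
  then obtain z where z: "((\<lambda>e. cnj (f e) *\<^sub>C e) has_sum z) E"
    by (auto simp: summable_on_def)
  have "f x = cinner z x" for x
  proof -
    have ze: "cinner z e = f e" if "e \<in> E" for e
    proof -
      have "((\<lambda>e'. cinner (cnj (f e') *\<^sub>C e') e) has_sum cinner z e) E"
        by (rule has_sum_bounded_linear[OF cinner.bounded_linear_left z])
      moreover have "((\<lambda>e'. cinner (cnj (f e') *\<^sub>C e') e) has_sum f e) E"
        using that by (intro has_sum_finite_neutralI[of "{e}"])
          (auto simp: cinner_scaleC_left cinner_self[of e] E)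
      ultimately show ?thesis
        using has_sum_unique by blast
    qed
    have "((\<lambda>e. f (cinner e x *\<^sub>C e)) has_sum f x) E"
      by (rule has_sum_bounded_linear[OF f onb_expansion[OF onb]])
    then have "((\<lambda>e. cinner z (cinner e x *\<^sub>C e)) has_sum f x) E"
      by (rule has_sum_cong[THEN iffD1, rotated]) (simp add: f_scale ze cinner_scaleC_right)
    moreover have "((\<lambda>e. cinner z (cinner e x *\<^sub>C e)) has_sum cinner z x) E"
      by (rule has_sum_bounded_linear[OF cinner.bounded_linear_right onb_expansion[OF onb]])
    ultimately show ?thesis
      using has_sum_unique by blast
  qed
  then show ?thesis
    using that by blast
qed

text \<open>For each x the functional y -> <x|A y> is bounded, and its Riesz vector is B x. The
  bound on B follows by taking y = B x.\<close>

lemma adj_exists: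
  fixes A :: "'a::chilbert \<Rightarrow> 'b::chilbert"
  assumes "bounded_clinear A"
  shows "\<exists>B. bounded_clinear B \<and> (\<forall>x y. cinner (B x) y = cinner x (A y))"
proof -
  obtain M where M: "M \<ge> 0" "\<And>x. norm (A x) \<le> M * norm x"
    using bounded_clinear_bound[OF assms] by blast
  have "\<exists>z. \<forall>y. cinner x (A y) = cinner z y" for x
  proof -
    have "bounded_clinear (\<lambda>y. cinner x (A y))"
    proof (rule bounded_clinearI[where M = "norm x * M"])
      show "norm (cinner x (A y)) \<le> norm x * M * norm y" for y
        using order_trans[OF Cauchy_Schwarz mult_left_mono[OF M(2)[of y] norm_ge_zero[of x]]]
        by (simp add: mult.assoc)
    qed (simp_all add: bounded_clinear_add[OF assms] bounded_clinear_scaleC[OF assms]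
        cinner_add_right cinner_scaleC_right scaleC_complex_def)
    then show ?thesis
      using Riesz_representation by metis
  qed
  then obtain B where B: "\<And>x y. cinner (B x) y = cinner x (A y)"
    by metis
  have ext: "u = v" if "\<And>y. cinner u y = cinner v y" for u v :: 'a
    using that cinner_commute by (metis cinner_ext)
  have "norm (B x) \<le> M * norm x" for x
  proof (cases "B x = 0")
    case False
    have "(norm (B x))\<^sup>2 = cmod (cinner x (A (B x)))"
      by (simp add: cinner_self norm_power flip: B)
    also have "\<dots> \<le> norm x * (M * norm (B x))"
      using order_trans[OF Cauchy_Schwarz mult_left_mono[OF M(2)[of "B x"] norm_ge_zero[of x]]] .
    finally have "norm (B x) * norm (B x) \<le> (M * norm x) * norm (B x)"
      by (simp add: power2_eq_square mult_ac)
    then show ?thesis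
      using False by simp
  qed (use M in simp)
  moreover have "B (x + y) = B x + B y" "B (c *\<^sub>C x) = c *\<^sub>C B x" for x y c
    by (rule ext; simp add: B cinner_add_left cinner_scaleC_left)+
  ultimately have "bounded_clinear B"
    by (intro bounded_clinearI[where M = M])
  then show ?thesis
    using B by blast
qed

lemma adj_unique:
  assumes "bounded_clinear B" "\<And>x y. cinner (B x) y = cinner x (A y)"
  shows "adj A = B"
  unfolding adj_def
proof (rule the_equality)
  fix B' assume B': "bounded_clinear B' \<and> (\<forall>x y. cinner (B' x) y = cinner x (A y))"
  show "B' = B"
  proof (rule ext)
    fix x
    have "cinner y (B' x) = cinner y (B x)" for y
      using B' assms(2) by (metis cinner_commute)
    then show "B' x = B x"
      by (rule cinner_ext)
  qed
qed (use assms in blast)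

lemma
  assumes "bounded_clinear A"
  shows bounded_clinear_adj: "bounded_clinear (adj A)"
    and cinner_adj_left: "cinner (adj A x) y = cinner x (A y)"
    and cinner_adj_right: "cinner y (adj A x) = cinner (A y) x"
proof -
  obtain B where B: "bounded_clinear B" "\<And>x y. cinner (B x) y = cinner x (A y)"
    using adj_exists[OF assms] by blast
  then have "adj A = B"
    by (rule adj_unique)
  then show "bounded_clinear (adj A)" and *: "cinner (adj A x) y = cinner x (A y)" for x y
    using B by auto
  show "cinner y (adj A x) = cinner (A y) x"
    using * cinner_commute by metis
qed

text \<open>Polarisation: reality of the form at x + y relates the imaginary parts of <x|A y> and
  <y|A x>, reality at x + i y relates their real parts.\<close>

lemma positive_op_symmetric:
  assumes "positive_op A"
  shows "cinner (A x) y = cinner x (A y)"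
proof -
  have A: "bounded_clinear A" and im: "Im (cinner z (A z)) = 0" for z
    using assms by (simp_all add: positive_op_def complex_nonneg_Reals_iff)
  have "Im (cinner x (A y)) + Im (cinner y (A x)) = 0"
    using im[of "x + y"] im[of x] im[of y]
    by (simp add: bounded_clinear_add[OF A] cinner_add_left cinner_add_right)
  moreover have "Re (cinner x (A y)) - Re (cinner y (A x)) = 0"
    using im[of "x + \<i> *\<^sub>C y"] im[of x] im[of y]
    by (simp add: bounded_clinear_add[OF A] bounded_clinear_scaleC[OF A] cinner_add_left
        cinner_add_right cinner_scaleC_left cinner_scaleC_right)
  ultimately have "cinner x (A y) = cnj (cinner y (A x))"
    by (simp add: complex_eq_iff)
  then show ?thesis
    using cinner_commute[of "A x" y] by simp
qed

lemma positive_op_eq_zero: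
  assumes "positive_op A" "cinner y (A y) = 0"
  shows "A y = 0"
proof (rule ccontr)
  assume nz: "A y \<noteq> 0"
  define z where "z = A y"
  have A: "bounded_clinear A" and nonneg: "Re (cinner u (A u)) \<ge> 0" for u
    using assms by (simp_all add: positive_op_def complex_nonneg_Reals_iff)
  define a where "a = Re (cinner z (A z))"
  \<comment> \<open>The form vanishes at y and equals t (t a - 2 |z|^2) at y - t z. A positive t
    with t a < 2 |z|^2 is thus contradictory; this choice gives t a \<le> |z|^2, and a + 1 keeps the
    denominator positive.\<close>
  define t where "t = (norm z)\<^sup>2 / (a + 1)"
  have a: "a \<ge> 0"
    using nonneg by (simp add: a_def)
  have z: "(norm z)\<^sup>2 > 0"
    using nz by (simp add: z_def)
  have yz: "cinner z (A y) = of_real ((norm z)\<^sup>2)" "cinner y (A z) = of_real ((norm z)\<^sup>2)"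
    using positive_op_symmetric[OF assms(1), of y z] cinner_self[of z] by (simp_all add: z_def)
  let ?c = "complex_of_real (- t)"
  have "0 \<le> Re (cinner (y + ?c *\<^sub>C z) (A (y + ?c *\<^sub>C z)))"
    by (rule nonneg)
  also have "\<dots> = t * (t * a) - 2 * (t * (norm z)\<^sup>2)"
    using assms(2) yz
    by (simp add: bounded_clinear_add[OF A] bounded_clinear_scaleC[OF A] cinner_add_left
        cinner_add_right cinner_scaleC_left cinner_scaleC_right a_def right_diff_distrib flip: of_real_minus of_real_power)
  also have "\<dots> = t * (t * a - 2 * (norm z)\<^sup>2)"
    by (simp add: algebra_simps)
  finally have "0 \<le> t * (t * a - 2 * (norm z)\<^sup>2)" .
  moreover have "t > 0"
    using a z by (simp add: t_def)
  ultimately have "2 * (norm z)\<^sup>2 \<le> t * a"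
    by (simp add: zero_le_mult_iff)
  also have "t * a \<le> (norm z)\<^sup>2"
    using a z by (simp add: t_def field_simps)
  finally show False
    using z by simp
qed

section \<open>Interchanging unconditional sums\<close>

text \<open>Joint summability and the row sums identify the total as s; the same total is then
  regrouped by columns. Summability of the column sums h is part of the conclusion.\<close>

lemma has_sum_interchange:
  fixes f :: "'i \<Rightarrow> 'j \<Rightarrow> 'a::banach"
  assumes "(\<lambda>(x, y). f x y) summable_on A \<times> B"
    and "\<And>x. x \<in> A \<Longrightarrow> (f x has_sum g x) B"
    and "\<And>y. y \<in> B \<Longrightarrow> ((\<lambda>x. f x y) has_sum h y) A"
    and "(g has_sum s) A"
  shows "(h has_sum s) B"
proof -
  have "((\<lambda>(x, y). f x y) has_sum s) (A \<times> B)"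
    using assms by (intro has_sum_SigmaI[where g = g]) auto
  then have "((\<lambda>(y, x). f x y) has_sum s) (B \<times> A)"
    by (subst (asm) has_sum_swap) simp
  then show ?thesis
    by (rule has_sum_Sigma[OF isUCont_plus, where B = "\<lambda>_. A"]) (simp add: assms(3))
qed

text \<open>Supplies the first premise of \<open>has_sum_interchange\<close>: a non-negative family
  is summable once its row sums are, and comparison passes this on to f.\<close>

lemma summable_on_product_dominated:
  fixes f :: "'i \<Rightarrow> 'j \<Rightarrow> 'a::banach"
  assumes "\<And>x y. x \<in> A \<Longrightarrow> y \<in> B \<Longrightarrow> norm (f x y) \<le> a x y"
    and "\<And>x. x \<in> A \<Longrightarrow> (a x has_sum \<alpha> x) B" and "\<alpha> summable_on A"
  shows "(\<lambda>(x, y). f x y) summable_on A \<times> B"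
proof -
  have "(\<lambda>(x, y). a x y) summable_on A \<times> B"
  proof (rule summable_on_SigmaI[where g = \<alpha>])
    show "0 \<le> (case (x, y) of (x, y) \<Rightarrow> a x y)" if "x \<in> A" "y \<in> B" for x y
      using order_trans[OF norm_ge_zero assms(1)[OF that]] by simp
  qed (simp_all add: assms)
  moreover have "norm (case z of (x, y) \<Rightarrow> f x y) \<le> (case z of (x, y) \<Rightarrow> a x y)" if "z \<in> A \<times> B" for z
    using that assms(1) by (cases z) simp
  ultimately have "(\<lambda>z. norm (case z of (x, y) \<Rightarrow> f x y)) summable_on A \<times> B"
    by (rule Infinite_Sum.abs_summable_on_comparison_test')
  then show ?thesis
    by (rule abs_summable_summable)
qed

section \<open>Operators on Hilbert tensor products\<close>

lemma
  assumes "hilbert_tensor t"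
  shows tensor_add_right: "t x (y + y') = t x y + t x y'"
    and tensor_scaleC_right: "t x (c *\<^sub>C y) = c *\<^sub>C t x y"
    and tensor_add_left: "t (x + x') y = t x y + t x' y"
    and tensor_scaleC_left: "t (c *\<^sub>C x) y = c *\<^sub>C t x y"
    and cinner_tensor: "cinner (t x y) (t x' y') = cinner x x' * cinner y y'"
    and tensor_dense: "closure (cspan {t x y | x y. True}) = UNIV"
  using assms by (auto simp: hilbert_tensor_def Vector_Spaces.linear_iff)

text \<open>Transfers results about one factor to the other, so that A \<otimes> 1 needs no separate
  construction.\<close>

lemma hilbert_tensor_swap:
  assumes "hilbert_tensor t"
  shows "hilbert_tensor (\<lambda>x y. t y x)"
proof -
  have "{t y x | x y. True} = {t x y | x y. True}"
    by blast
  with assms show ?thesis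
    by (simp add: hilbert_tensor_def mult.commute)
qed

lemma norm_tensor:
  assumes "hilbert_tensor t"
  shows "norm (t x y) = norm x * norm y"
proof -
  have "complex_of_real ((norm (t x y))\<^sup>2) = complex_of_real ((norm x * norm y)\<^sup>2)"
    using cinner_tensor[OF assms, of x y x y] by (simp only: cinner_self of_real_mult power_mult_distrib)
  then have "(norm (t x y))\<^sup>2 = (norm x * norm y)\<^sup>2"
    using of_real_eq_iff by blast
  then show ?thesis
    by (simp add: power2_eq_iff_nonneg)
qed

lemma bounded_clinear_tensor_right:
  assumes "hilbert_tensor t"
  shows "bounded_clinear (t x)"
  by (rule bounded_clinearI[where M = "norm x"])
    (simp_all add: tensor_add_right[OF assms] tensor_scaleC_right[OF assms] norm_tensor[OF assms])

lemma bounded_clinear_tensor_left: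
  assumes "hilbert_tensor t"
  shows "bounded_clinear (\<lambda>x. t x y)"
  using bounded_clinear_tensor_right[OF hilbert_tensor_swap[OF assms]] .

text \<open>The slice \<open>adj (t x) u\<close> is the partial inner product of \<open>x\<close> with \<open>u\<close>.\<close>

lemma
  assumes "hilbert_tensor t"
  shows bounded_clinear_slice: "bounded_clinear (adj (t x))"
    and cinner_slice_right: "cinner y (adj (t x) u) = cinner (t x y) u"
    and cinner_slice_left: "cinner (adj (t x) u) y = cinner u (t x y)"
  using bounded_clinear_adj[OF bounded_clinear_tensor_right[OF assms]]
    cinner_adj_right[OF bounded_clinear_tensor_right[OF assms]]
    cinner_adj_left[OF bounded_clinear_tensor_right[OF assms]] by auto

lemma slice_tensor:
  assumes "hilbert_tensor t"
  shows "adj (t x) (t x' y) = cinner x x' *\<^sub>C y"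
  by (rule cinner_ext)
    (simp add: cinner_slice_right[OF assms] cinner_tensor[OF assms] cinner_scaleC_right)

lemma tensor_eqI:
  assumes "hilbert_tensor t" and "\<And>x y. cinner (t x y) u = cinner (t x y) v"
  shows "u = v"
proof -
  have "u - v = 0"
    using assms(2)
    by (intro eq_zero_if_cinner_zero[OF tensor_dense[OF assms(1)]]) (auto simp: cinner.diff_right)
  then show ?thesis
    by simp
qed

lemma tensor_eqI_slice:
  assumes "hilbert_tensor t" and "\<And>x. adj (t x) u = adj (t x) v"
  shows "u = v"
  using assms(2) by (intro tensor_eqI[OF assms(1)]) (simp flip: cinner_slice_right[OF assms(1)])

lemma tensor_operator_eqI:
  assumes "hilbert_tensor t" "bounded_clinear C" "bounded_clinear D"
    and "\<And>x y. C (t x y) = D (t x y)"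
  shows "C = D"
  using assms(4) by (intro bounded_clinear_eqI[OF assms(2,3) tensor_dense[OF assms(1)]]) auto

text \<open>Components at different basis vectors are orthogonal, so Bessel's inequality gives
  convergence. The limit has the same inner products with elementary tensors as u, as one sees by
  expanding x instead of u.\<close>

lemma tensor_expansion:
  assumes t: "hilbert_tensor t" and onb: "is_onb E"
  shows "((\<lambda>e. t e (adj (t e) u)) has_sum u) E"
proof -
  have E: "\<And>e. e \<in> E \<Longrightarrow> norm e = 1" "\<And>e f. e \<in> E \<Longrightarrow> f \<in> E \<Longrightarrow> e \<noteq> f \<Longrightarrow> cinner e f = 0"
    using onb by (auto simp: is_onb_def)
  have "cinner u (t e (adj (t e) u)) = cinner (t e (adj (t e) u)) (t e (adj (t e) u))" if "e \<in> E" for e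
    using E(1)[OF that] cinner_slice_left[OF t, of e u "adj (t e) u"]
    by (simp add: cinner_tensor[OF t] cinner_self[of e])
  then have "(\<lambda>e. t e (adj (t e) u)) summable_on E"
    by (intro orthogonal_components_summable_on[of E _ u]) (simp_all add: cinner_tensor[OF t] E)
  then obtain p where p: "((\<lambda>e. t e (adj (t e) u)) has_sum p) E"
    by (auto simp: summable_on_def)
  have "cinner (t x y) p = cinner (t x y) u" for x y
  proof (rule has_sum_unique)
    show "((\<lambda>e. cinner (t x y) (t e (adj (t e) u))) has_sum cinner (t x y) p) E"
      by (rule has_sum_bounded_linear[OF cinner.bounded_linear_right p])
    have "((\<lambda>e. t (cinner e x *\<^sub>C e) y) has_sum t x y) E"
      by (rule has_sum_bounded_linear[OF bounded_clinear_bounded_linear[OF bounded_clinear_tensor_left[OF t]]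
            onb_expansion[OF onb]])
    then have "((\<lambda>e. cinner (t (cinner e x *\<^sub>C e) y) u) has_sum cinner (t x y) u) E"
      by (rule has_sum_bounded_linear[OF cinner.bounded_linear_left])
    then show "((\<lambda>e. cinner (t x y) (t e (adj (t e) u))) has_sum cinner (t x y) u) E"
      by (rule has_sum_cong[THEN iffD1, rotated])
        (simp add: cinner_tensor[OF t] tensor_scaleC_left[OF t] cinner_scaleC_left
          cinner_slice_right[OF t] cinner_commute[of x])
  qed
  then have "p = u"
    by (rule tensor_eqI[OF t])
  then show ?thesis
    using p by simp
qed

lemma cinner_slices:
  assumes "hilbert_tensor t" "is_onb E"
  shows "((\<lambda>e. cinner (adj (t e) u) (adj (t e) v)) has_sum cinner u v) E"
  using has_sum_bounded_linear[OF cinner.bounded_linear_right[of u] tensor_expansion[OF assms, of v]]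
  by (simp add: cinner_slice_left[OF assms(1)])

lemma norm_slices:
  assumes "hilbert_tensor t" "is_onb E"
  shows "((\<lambda>e. (norm (adj (t e) u))\<^sup>2) has_sum (norm u)\<^sup>2) E"
  using has_sum_Re[OF cinner_slices[OF assms, of u u]] by (simp add: cinner_self)

text \<open>Boundedness on elementary tensors does not suffice for an extension. The last hypothesis
  keeps the images of different components of u orthogonal, so that the norm of C u is bounded
  through Pythagoras instead of the triangle inequality.\<close>

lemma tensor_extension:
  fixes t :: "'a::chilbert \<Rightarrow> 'b::chilbert \<Rightarrow> 'c::chilbert" and s :: "'a \<Rightarrow> 'b \<Rightarrow> 'd::chilbert"
  assumes t: "hilbert_tensor t"
    and s_right: "\<And>x. bounded_clinear (s x)" and s_left: "\<And>y. bounded_clinear (\<lambda>x. s x y)"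
    and bound: "\<And>x y. norm (s x y) \<le> M * norm x * norm y" and "M \<ge> 0"
    and orth: "\<And>x x' y y'. cinner x x' = 0 \<Longrightarrow> cinner (s x y) (s x' y') = 0"
  obtains C where "bounded_clinear C" "\<And>x y. C (t x y) = s x y"
proof -
  obtain E :: "'a set" where onb: "is_onb E"
    using onb_exists by blast
  then have E: "\<And>e. e \<in> E \<Longrightarrow> norm e = 1" "\<And>e f. e \<in> E \<Longrightarrow> f \<in> E \<Longrightarrow> e \<noteq> f \<Longrightarrow> cinner e f = 0"
    by (auto simp: is_onb_def)
  define g where "g u e = s e (adj (t e) u)" for u e
  define C where "C u = infsum (g u) E" for u
  have g_orth: "cinner (g u e) (g u f) = 0" if "e \<in> E" "f \<in> E" "e \<noteq> f" for u e f
    using that by (simp add: g_def orth E)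
  have g_bound: "(norm (g u e))\<^sup>2 \<le> M\<^sup>2 * (norm (adj (t e) u))\<^sup>2" if "e \<in> E" for u e
    using power_mono[OF bound[of e "adj (t e) u"], of 2] E(1)[OF that]
    by (simp add: g_def power_mult_distrib)
  have sq: "((\<lambda>e. M\<^sup>2 * (norm (adj (t e) u))\<^sup>2) has_sum M\<^sup>2 * (norm u)\<^sup>2) E" for u
    by (rule has_sum_cmult_right[OF norm_slices[OF t onb]])
  have gC: "(g u has_sum C u) E" for u
  proof -
    have "(\<lambda>e. (norm (g u e))\<^sup>2) summable_on E"
      by (rule summable_on_comparison_test[OF has_sum_imp_summable[OF sq[of u]]])
        (use g_bound in auto)
    with g_orth have "g u summable_on E"
      by (rule orthogonal_summable_on)
    then show ?thesis
      by (simp add: C_def)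
  qed
  have "C (u + v) = C u + C v" for u v
  proof (rule has_sum_unique[OF gC])
    show "(g (u + v) has_sum C u + C v) E"
      using has_sum_add[OF gC[of u] gC[of v]]
      by (simp add: g_def[abs_def] bounded_clinear_add[OF s_right]
          bounded_clinear_add[OF bounded_clinear_slice[OF t]])
  qed
  moreover have "C (c *\<^sub>C u) = c *\<^sub>C C u" for c u
  proof (rule has_sum_unique[OF gC])
    show "(g (c *\<^sub>C u) has_sum c *\<^sub>C C u) E"
      using has_sum_bounded_linear[OF bounded_linear_scaleC gC[of u]]
      by (simp add: g_def[abs_def] bounded_clinear_scaleC[OF s_right]
          bounded_clinear_scaleC[OF bounded_clinear_slice[OF t]])
  qed
  moreover have "norm (C u) \<le> M * norm u" for u
  proof -
    have "((\<lambda>e. (norm (g u e))\<^sup>2) has_sum (norm (C u))\<^sup>2) E"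
      using g_orth gC by (rule orthogonal_has_sum_norm_sq)
    from has_sum_mono[OF this sq[of u] g_bound] have "(norm (C u))\<^sup>2 \<le> (M * norm u)\<^sup>2"
      by (simp add: power_mult_distrib)
    then show ?thesis
      by (rule power2_le_imp_le) (simp add: \<open>M \<ge> 0\<close>)
  qed
  ultimately have "bounded_clinear C"
    by (intro bounded_clinearI[where M = M])
  moreover have "C (t x y) = s x y" for x y
  proof (rule has_sum_unique[OF gC])
    \<comment> \<open>The slice of t x y at e is <e|x> y, so this series is the expansion of x
      carried through s.\<close>
    show "(g (t x y) has_sum s x y) E"
      using has_sum_bounded_linear[OF bounded_clinear_bounded_linear[OF s_left] onb_expansion[OF onb, of x]]
      by (simp add: g_def[abs_def] slice_tensor[OF t] bounded_clinear_scaleC[OF s_right]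
          bounded_clinear_scaleC[OF s_left])
  qed
  ultimately show ?thesis
    using that by blast
qed

lemma tensor_extension_right:
  assumes t: "hilbert_tensor t" and t': "hilbert_tensor t'" and B: "bounded_clinear B"
  obtains C where "bounded_clinear C" "\<And>x y. C (t x y) = t' x (B y)"
proof -
  obtain M where M: "M \<ge> 0" "\<And>y. norm (B y) \<le> M * norm y"
    using bounded_clinear_bound[OF B] by blast
  show ?thesis
  proof (rule tensor_extension[OF t _ _ _ M(1) _ that])
    show "bounded_clinear (\<lambda>y. t' x (B y))" for x
      by (rule bounded_clinear_compose[OF bounded_clinear_tensor_right[OF t'] B])
    show "bounded_clinear (\<lambda>x. t' x (B y))" for y
      by (rule bounded_clinear_tensor_left[OF t'])
    show "norm (t' x (B y)) \<le> M * norm x * norm y" for x y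
      using mult_left_mono[OF M(2)[of y] norm_ge_zero[of x]] by (simp add: norm_tensor[OF t'] mult_ac)
    show "cinner (t' x (B y)) (t' x' (B y')) = 0" if "cinner x x' = 0" for x x' y y'
      using that by (simp add: cinner_tensor[OF t'])
  qed
qed

section \<open>Tensor products of operators\<close>

lemma tensor_op_unique:
  assumes "hilbert_tensor t" "bounded_clinear C" "\<And>x y. C (t x y) = t' (A x) (B y)"
  shows "tensor_op t t' A B = C"
  unfolding tensor_op_def
  using assms by (intro the_equality tensor_operator_eqI[OF assms(1)]) auto

text \<open>A general A does not preserve orthogonality, so \<open>tensor_extension\<close> does not
  apply to A \<otimes> B directly. The operator is built as (1 \<otimes> B)(A \<otimes> 1), with A
  \<otimes> 1 obtained by exchanging the factors.\<close>

lemma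
  fixes t :: "'a::chilbert \<Rightarrow> 'b::chilbert \<Rightarrow> 'c::chilbert" and t' :: "'a \<Rightarrow> 'b'::chilbert \<Rightarrow> 'c'::chilbert"
  assumes t: "hilbert_tensor t" and t': "hilbert_tensor t'"
    and A: "bounded_clinear A" and B: "bounded_clinear B"
  shows bounded_clinear_tensor_op: "bounded_clinear (tensor_op t t' A B)"
    and tensor_op_apply: "tensor_op t t' A B (t x y) = t' (A x) (B y)"
proof -
  obtain C\<^sub>1 where C\<^sub>1: "bounded_clinear C\<^sub>1" "\<And>y x. C\<^sub>1 (t x y) = t (A x) y"
    using tensor_extension_right[OF hilbert_tensor_swap[OF t] hilbert_tensor_swap[OF t] A] by blast
  obtain C\<^sub>2 where C\<^sub>2: "bounded_clinear C\<^sub>2" "\<And>x y. C\<^sub>2 (t x y) = t' x (B y)"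
    using tensor_extension_right[OF t t' B] by blast
  have "tensor_op t t' A B = (\<lambda>u. C\<^sub>2 (C\<^sub>1 u))"
    using C\<^sub>1(2) C\<^sub>2(2) by (intro tensor_op_unique[OF t bounded_clinear_compose[OF C\<^sub>2(1) C\<^sub>1(1)]]) simp
  then show "bounded_clinear (tensor_op t t' A B)" "tensor_op t t' A B (t x y) = t' (A x) (B y)"
    using C\<^sub>1(2) C\<^sub>2(2) bounded_clinear_compose[OF C\<^sub>2(1) C\<^sub>1(1)] by simp_all
qed

lemma slice_tensor_op_right:
  fixes t :: "'a::chilbert \<Rightarrow> 'b::chilbert \<Rightarrow> 'c::chilbert" and t' :: "'a \<Rightarrow> 'b'::chilbert \<Rightarrow> 'c'::chilbert"
  assumes t: "hilbert_tensor t" and t': "hilbert_tensor t'" and B: "bounded_clinear B"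
  shows "adj (t' x) (tensor_op t t' id B u) = B (adj (t x) u)"
proof -
  note 1 = bounded_clinear_tensor_op[OF t t' bounded_clinear_id B]
  have "(\<lambda>u. adj (t' x) (tensor_op t t' id B u)) = (\<lambda>u. B (adj (t x) u))"
    by (rule tensor_operator_eqI[OF t bounded_clinear_compose[OF bounded_clinear_slice[OF t'] 1]
          bounded_clinear_compose[OF B bounded_clinear_slice[OF t]]])
      (simp add: tensor_op_apply[OF t t' bounded_clinear_id B] slice_tensor[OF t] slice_tensor[OF t']
        bounded_clinear_scaleC[OF B])
  then show ?thesis
    by metis
qed

lemma tensor_op_compose:
  fixes t :: "'a::chilbert \<Rightarrow> 'b::chilbert \<Rightarrow> 'c::chilbert"
    and t' :: "'a \<Rightarrow> 'b'::chilbert \<Rightarrow> 'c'::chilbert"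
    and t'' :: "'a \<Rightarrow> 'b''::chilbert \<Rightarrow> 'c''::chilbert"
  assumes "hilbert_tensor t" "hilbert_tensor t'" "hilbert_tensor t''"
    and "bounded_clinear A" "bounded_clinear B" "bounded_clinear A'" "bounded_clinear B'"
  shows "tensor_op t' t'' A' B' (tensor_op t t' A B u) = tensor_op t t'' (A' \<circ> A) (B' \<circ> B) u"
proof -
  have "tensor_op t t'' (A' \<circ> A) (B' \<circ> B) = (\<lambda>u. tensor_op t' t'' A' B' (tensor_op t t' A B u))"
    by (rule tensor_op_unique[OF assms(1) bounded_clinear_compose[OF
            bounded_clinear_tensor_op[OF assms(2,3,6,7)] bounded_clinear_tensor_op[OF assms(1,2,4,5)]]])
      (simp add: tensor_op_apply assms)
  then show ?thesis
    by simp
qed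

lemma tensor_op_id: "hilbert_tensor t \<Longrightarrow> tensor_op t t id id = id"
  by (rule tensor_op_unique) (simp_all add: bounded_clinear_id)

lemma tensor_op_rank_one:
  assumes t: "hilbert_tensor t"
  shows "tensor_op t t (rank_one x' x) (rank_one y' y) = rank_one (t x' y') (t x y)"
  by (rule tensor_op_unique[OF t bounded_clinear_rank_one])
    (simp add: rank_one_def cinner_tensor[OF t] tensor_scaleC_left[OF t] tensor_scaleC_right[OF t]
      scaleC_scaleC mult.commute)

text \<open>The first factor |x><x'| takes the slice at x' and tensors the result with x. This turns
  the Choi identity into a statement about slices.\<close>

lemma tensor_op_rank_one_left:
  assumes t: "hilbert_tensor t" and B: "bounded_clinear B"
  shows "tensor_op t t (rank_one x x') B u = t x (B (adj (t x') u))"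
proof -
  have "tensor_op t t (rank_one x x') B = (\<lambda>u. t x (B (adj (t x') u)))"
    by (rule tensor_op_unique[OF t bounded_clinear_compose[OF bounded_clinear_tensor_right[OF t]
            bounded_clinear_compose[OF B bounded_clinear_slice[OF t]]]])
      (simp add: slice_tensor[OF t] rank_one_def tensor_scaleC_left[OF t] tensor_scaleC_right[OF t]
        bounded_clinear_scaleC[OF B])
  then show ?thesis
    by simp
qed

section \<open>The flip of the two factors\<close>

lemma
  fixes t :: "'a::chilbert \<Rightarrow> 'a \<Rightarrow> 'c::chilbert"
  assumes t: "hilbert_tensor t"
  shows bounded_clinear_tensor_flip: "bounded_clinear (tensor_flip t)"
    and tensor_flip_apply: "tensor_flip t (t x y) = t y x"
proof -
  obtain F where F: "bounded_clinear F" "\<And>x y. F (t x y) = t y x"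
  proof (rule tensor_extension[OF t])
    show "bounded_clinear (\<lambda>y. t y x)" for x
      by (rule bounded_clinear_tensor_left[OF t])
    show "bounded_clinear (\<lambda>x. t y x)" for y
      by (rule bounded_clinear_tensor_right[OF t])
    show "norm (t y x) \<le> 1 * norm x * norm y" for x y
      by (simp add: norm_tensor[OF t])
    show "cinner (t y x) (t y' x') = 0" if "cinner x x' = 0" for x x' y y'
      using that by (simp add: cinner_tensor[OF t])
  qed auto
  have "tensor_flip t = F"
    unfolding tensor_flip_def using F by (intro the_equality tensor_operator_eqI[OF t]) auto
  with F show "bounded_clinear (tensor_flip t)" "tensor_flip t (t x y) = t y x"
    by simp_all
qed

lemma tensor_flip_flip:
  assumes t: "hilbert_tensor t"
  shows "tensor_flip t (tensor_flip t u) = u"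
proof -
  note F = bounded_clinear_tensor_flip[OF t]
  have "(\<lambda>u. tensor_flip t (tensor_flip t u)) = id"
    by (rule tensor_operator_eqI[OF t bounded_clinear_compose[OF F F] bounded_clinear_id])
      (simp add: tensor_flip_apply[OF t])
  then show ?thesis
    by (metis id_apply)
qed

lemma cinner_tensor_flip:
  assumes t: "hilbert_tensor t"
  shows "cinner (tensor_flip t u) v = cinner u (tensor_flip t v)"
proof -
  note F = bounded_clinear_tensor_flip[OF t]
  have "adj (tensor_flip t) = tensor_flip t"
  proof (rule tensor_operator_eqI[OF t bounded_clinear_adj[OF F] F])
    show "adj (tensor_flip t) (t x y) = tensor_flip t (t x y)" for x y
      by (rule tensor_eqI[OF t])
        (simp add: cinner_adj_right[OF F] tensor_flip_apply[OF t] cinner_tensor[OF t] mult.commute)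
  qed
  then show ?thesis
    using cinner_adj_left[OF F] by metis
qed

lemma tensor_flip_tensor_op:
  assumes t: "hilbert_tensor t" and "bounded_clinear A" "bounded_clinear B"
  shows "tensor_flip t (tensor_op t t A B u) = tensor_op t t B A (tensor_flip t u)"
proof -
  note F = bounded_clinear_tensor_flip[OF t]
  have "(\<lambda>u. tensor_flip t (tensor_op t t A B u)) = (\<lambda>u. tensor_op t t B A (tensor_flip t u))"
    by (rule tensor_operator_eqI[OF t bounded_clinear_compose[OF F bounded_clinear_tensor_op[OF t t assms(2,3)]]
          bounded_clinear_compose[OF bounded_clinear_tensor_op[OF t t assms(3,2)] F]])
      (simp add: tensor_flip_apply[OF t] tensor_op_apply assms)
  then show ?thesis
    by metis
qed

text \<open>Moves the flip from the vectors to the operators: the Choi identity contains \<Phi>(B)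
  \<otimes> A', whereas the slices are adapted to A' \<otimes> \<Phi>(B).\<close>

lemma cinner_flipped_tensor_op:
  assumes t: "hilbert_tensor t" and "bounded_clinear A" "bounded_clinear B"
  shows "cinner (tensor_flip t u) (tensor_op t t A B (tensor_flip t v)) = cinner u (tensor_op t t B A v)"
  using assms
  by (simp add: cinner_tensor_flip[OF t] tensor_flip_flip[OF t] tensor_flip_tensor_op[OF t])

section \<open>Traces of operators with a rank-one decomposition\<close>

text \<open>The sharp factor 1/2 is given up, since the bound only has to dominate summable
  families.\<close>

lemma mult_le_sum_squares: "(a::real) * b \<le> a\<^sup>2 + b\<^sup>2"
  using sum_squares_bound[of a b] zero_le_power2[of a] zero_le_power2[of b] by linarith

lemma cmod_cinner_commute: "cmod (cinner x y) = cmod (cinner y x)"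
  using cinner_commute[of x y] by simp

lemma op_trace_rank_one:
  assumes "bounded_clinear S"
  shows "op_trace (S \<circ> rank_one a b) = cinner b (S a)"
proof -
  have "((\<lambda>e. cinner e (S (rank_one a b e))) has_sum cinner b (S a)) (SOME E. is_onb E)"
    using Parseval[OF is_onb_some, of b "S a"]
    by (simp add: rank_one_def bounded_clinear_scaleC[OF assms] cinner_scaleC_right)
  then show ?thesis
    by (simp add: op_trace_def infsumI)
qed

text \<open>The family <w_l|C e><e|w_l> is summed in two orders: over e, Parseval gives <w_l|C w_l>;
  over l, the decomposition of S gives <e|S C e>.\<close>

lemma has_sum_decomposition_diagonal:
  assumes S: "\<And>x. ((\<lambda>l. cinner (w l) x *\<^sub>C w l) has_sum S x) L"
    and w: "(\<lambda>l. (norm (w l))\<^sup>2) summable_on L"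
    and C: "bounded_clinear C" and onb: "is_onb E"
    and s: "((\<lambda>l. cinner (w l) (C (w l))) has_sum s) L"
  shows "((\<lambda>e. cinner e (S (C e))) has_sum s) E"
proof (rule has_sum_interchange)
  let ?f = "\<lambda>l e. cinner (w l) (C e) * cinner e (w l)"
  obtain M where M: "M \<ge> 0" "\<And>x. norm (adj C x) \<le> M * norm x"
    using bounded_clinear_bound[OF bounded_clinear_adj[OF C]] by blast
  show "(\<lambda>(l, e). ?f l e) summable_on L \<times> E"
  proof (rule summable_on_product_dominated)
    show "norm (?f l e) \<le> (cmod (cinner e (adj C (w l))))\<^sup>2 + (cmod (cinner e (w l)))\<^sup>2" for l e
      using mult_le_sum_squares cmod_cinner_commute[of e "adj C (w l)"]
      by (simp add: norm_mult cinner_adj_left[OF C])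
    show "((\<lambda>e. (cmod (cinner e (adj C (w l))))\<^sup>2 + (cmod (cinner e (w l)))\<^sup>2) has_sum
        (norm (adj C (w l)))\<^sup>2 + (norm (w l))\<^sup>2) E" for l
      by (intro has_sum_add Parseval_norm onb)
    have "(\<lambda>l. (norm (adj C (w l)))\<^sup>2) summable_on L"
    proof (rule summable_on_comparison_test[OF summable_on_cmult_right[OF w, of "M\<^sup>2"]])
      show "(norm (adj C (w l)))\<^sup>2 \<le> M\<^sup>2 * (norm (w l))\<^sup>2" for l
        using power_mono[OF M(2)[of "w l"], of 2] by (simp add: power_mult_distrib)
    qed simp
    then show "(\<lambda>l. (norm (adj C (w l)))\<^sup>2 + (norm (w l))\<^sup>2) summable_on L"
      using w by (rule summable_on_add)
  qed
  show "(?f l has_sum cinner (w l) (C (w l))) E" for l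
    using Parseval[OF onb, of "adj C (w l)" "w l"] by (simp add: cinner_adj_left[OF C])
  show "((\<lambda>l. ?f l e) has_sum cinner e (S (C e))) L" for e
    using has_sum_bounded_linear[OF cinner.bounded_linear_right[of e] S[of "C e"]]
    by (simp add: cinner_scaleC_right)
qed (rule s)

lemma op_trace_decomposition:
  assumes S: "\<And>x. ((\<lambda>l. cinner (w l) x *\<^sub>C w l) has_sum S x) L"
    and w: "(\<lambda>l. (norm (w l))\<^sup>2) summable_on L" and C: "bounded_clinear C"
  shows "((\<lambda>l. cinner (w l) (C (w l))) has_sum op_trace (S \<circ> C)) L"
proof -
  obtain M where M: "M \<ge> 0" "\<And>x. norm (C x) \<le> M * norm x"
    using bounded_clinear_bound[OF C] by blast
  have "norm (cinner (w l) (C (w l))) \<le> M * (norm (w l))\<^sup>2" for l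
    using order_trans[OF Cauchy_Schwarz mult_left_mono[OF M(2)[of "w l"] norm_ge_zero[of "w l"]]]
    by (simp add: power2_eq_square mult_ac)
  with summable_on_cmult_right[OF w, of M]
  have "(\<lambda>l. norm (cinner (w l) (C (w l)))) summable_on L"
    by (rule Infinite_Sum.abs_summable_on_comparison_test')
  from abs_summable_summable[OF this] obtain s where s: "((\<lambda>l. cinner (w l) (C (w l))) has_sum s) L"
    unfolding summable_on_def by blast
  from has_sum_decomposition_diagonal[OF S w C is_onb_some s] have "op_trace (S \<circ> C) = s"
    by (simp add: op_trace_def infsumI)
  with s show ?thesis
    by simp
qed

lemma has_sum_norm_sq_iff:
  "((\<lambda>l. cinner (w l) (w l)) has_sum complex_of_real s) L \<longleftrightarrow> ((\<lambda>l. (norm (w l))\<^sup>2) has_sum s) L"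
  unfolding cinner_self by (rule has_sum_of_real_iff)

text \<open>The numbers |<w_l|e>|^2 sum over l to <e|S e> and over e to the squared norm of w_l.
  Being non-negative, they serve as their own majorant.\<close>

lemma decomposition_norm_sq_has_sum:
  assumes "S \<in> states" and S: "\<And>x. ((\<lambda>l. cinner (w l) x *\<^sub>C w l) has_sum S x) L"
  shows "((\<lambda>l. (norm (w l))\<^sup>2) has_sum 1) L"
proof -
  let ?E = "SOME E::'a set. is_onb E"
  let ?f = "\<lambda>e l. cinner (w l) e * cinner e (w l)"
  have "infsum (\<lambda>e. cinner e (S e)) ?E = 1"
    using assms(1) by (simp add: states_def op_trace_def)
  \<comment> \<open>\<open>infsum\<close> is 0 when there is no sum, so the value 1 certifies
    convergence.\<close>
  then have trace: "((\<lambda>e. cinner e (S e)) has_sum 1) ?E"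
    using infsum_not_exists[of "\<lambda>e. cinner e (S e)" ?E] has_sum_infsum by fastforce
  have f: "?f e l = complex_of_real ((cmod (cinner (w l) e))\<^sup>2)" for e l
    using cinner_commute[of e "w l"] by (simp only: complex_norm_square)
  have row: "(?f e has_sum cinner e (S e)) L" for e
    using has_sum_bounded_linear[OF cinner.bounded_linear_right[of e] S[of e]]
    by (simp add: cinner_scaleC_right)
  have "((\<lambda>l. cinner (w l) (w l)) has_sum 1) L"
  proof (rule has_sum_interchange[OF _ row _ trace])
    show "(\<lambda>(e, l). ?f e l) summable_on ?E \<times> L"
    proof (rule summable_on_product_dominated)
      show "norm (?f e l) \<le> (cmod (cinner (w l) e))\<^sup>2" for e l
        by (simp only: f norm_of_real) simp
      show "((\<lambda>l. (cmod (cinner (w l) e))\<^sup>2) has_sum Re (cinner e (S e))) L" for e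
        using has_sum_Re[OF row[of e]] unfolding f by simp
      show "(\<lambda>e. Re (cinner e (S e))) summable_on ?E"
        using has_sum_Re[OF trace] by (rule has_sum_imp_summable)
    qed
    show "((\<lambda>e. ?f e l) has_sum cinner (w l) (w l)) ?E" for l
      by (rule Parseval[OF is_onb_some])
  qed
  then show ?thesis
    using has_sum_norm_sq_iff[of w L 1] by simp
qed

lemma positive_op_adj: "positive_op A \<Longrightarrow> adj A = A"
  by (intro adj_unique positive_op_symmetric) (auto simp: positive_op_def)

text \<open>Each term has norm at most |x| |w_l|^2, so the series for S x converges absolutely and S
  has bound 1.\<close>

lemma state_of_decomposition:
  fixes w :: "'l \<Rightarrow> 'a::chilbert"
  assumes w: "((\<lambda>l. (norm (w l))\<^sup>2) has_sum 1) L"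
  obtains S where "S \<in> states" "\<And>x. ((\<lambda>l. cinner (w l) x *\<^sub>C w l) has_sum S x) L"
proof -
  define S where "S x = infsum (\<lambda>l. cinner (w l) x *\<^sub>C w l) L" for x
  have bound: "norm (cinner (w l) x *\<^sub>C w l) \<le> norm x * (norm (w l))\<^sup>2" for l x
    using mult_right_mono[OF Cauchy_Schwarz[of "w l" x] norm_ge_zero[of "w l"]]
    by (simp add: norm_scaleC power2_eq_square mult_ac)
  have sq: "((\<lambda>l. norm x * (norm (w l))\<^sup>2) has_sum norm x) L" for x :: 'a
    using has_sum_cmult_right[OF w, of "norm x"] by simp
  have S: "((\<lambda>l. cinner (w l) x *\<^sub>C w l) has_sum S x) L" for x
  proof -
    have "(\<lambda>l. norm (cinner (w l) x *\<^sub>C w l)) summable_on L"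
      using has_sum_imp_summable[OF sq[of x]] bound
      by (rule Infinite_Sum.abs_summable_on_comparison_test')
    then show ?thesis
      unfolding S_def by (intro has_sum_infsum) (rule abs_summable_summable)
  qed
  have bS: "bounded_clinear S"
  proof (rule bounded_clinearI[where M = 1])
    show "S (x + y) = S x + S y" for x y
      using has_sum_add[OF S[of x] S[of y]]
      by (intro has_sum_unique[OF S]) (simp add: cinner_add_right scaleC_add_left)
    show "S (c *\<^sub>C x) = c *\<^sub>C S x" for c x
      using has_sum_bounded_linear[OF bounded_linear_scaleC[of c] S[of x]]
      by (intro has_sum_unique[OF S]) (simp add: cinner_scaleC_right scaleC_scaleC)
    show "norm (S x) \<le> 1 * norm x" for x
      using norm_infsum_le[OF S sq bound] by simp
  qed
  have "cinner x (S x) \<in> \<real>\<^sub>\<ge>\<^sub>0" for x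
  proof -
    have "((\<lambda>l. cinner (w l) x * cinner x (w l)) has_sum cinner x (S x)) L"
      using has_sum_bounded_linear[OF cinner.bounded_linear_right[of x] S[of x]]
      by (simp add: cinner_scaleC_right)
    moreover have "cinner (w l) x * cinner x (w l) = complex_of_real ((cmod (cinner (w l) x))\<^sup>2)" for l
      using cinner_commute[of x "w l"] by (simp only: complex_norm_square)
    ultimately have sum: "((\<lambda>l. complex_of_real ((cmod (cinner (w l) x))\<^sup>2)) has_sum cinner x (S x)) L"
      by simp
    have "((\<lambda>l. 0) has_sum Im (cinner x (S x))) L"
      using has_sum_Im[OF sum] by simp
    then have "Im (cinner x (S x)) = 0"
      by (rule has_sum_unique) simp
    moreover have "Re (cinner x (S x)) \<ge> 0"
      by (rule has_sum_nonneg[OF has_sum_Re[OF sum]]) simp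
    ultimately show ?thesis
      by (simp add: complex_nonneg_Reals_iff)
  qed
  with bS have pos: "positive_op S"
    by (simp add: positive_op_def)
  have trace: "((\<lambda>l. cinner (w l) (w l)) has_sum 1) L"
    using w has_sum_norm_sq_iff[of w L 1] by simp
  note diagonal = has_sum_decomposition_diagonal[OF S has_sum_imp_summable[OF w] bounded_clinear_id
      is_onb_some, simplified, OF trace]
  then have "(\<lambda>e. cinner e (S e)) summable_on (SOME E. is_onb E)"
    by (rule has_sum_imp_summable)
  \<comment> \<open>A positive operator is its own absolute value, so S itself is the P required by
    \<open>trace_class\<close>.\<close>
  with pos bS have "trace_class S"
    unfolding trace_class_def positive_op_adj[OF pos] using is_onb_some by blast
  moreover have "op_trace S = 1"
    unfolding op_trace_def using diagonal by (rule infsumI)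
  ultimately have "S \<in> states"
    using pos by (simp add: states_def)
  with S show ?thesis
    using that by blast
qed

section \<open>Choi states of Kraus families\<close>

text \<open>Rank-one A' and B turn the defining identity into the matrix elements of S between
  elementary tensors.\<close>

lemma choi_state_unique:
  assumes t: "hilbert_tensor t'" and S: "is_choi_state t t' \<Omega> \<Phi> S" "is_choi_state t t' \<Omega> \<Phi> S'"
  shows "S = S'"
proof -
  have b: "bounded_clinear S" "bounded_clinear S'"
    using S by (auto simp: is_choi_state_def states_def positive_op_def)
  have "cinner (t' x y) (S (t' x' y')) = cinner (t' x y) (S' (t' x' y'))" for x y x' y'
  proof -
    have "op_trace (S \<circ> tensor_op t' t' (rank_one x' x) (rank_one y' y)) =
        op_trace (S' \<circ> tensor_op t' t' (rank_one x' x) (rank_one y' y))"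
      using S bounded_clinear_rank_one unfolding is_choi_state_def by metis
    then show ?thesis
      by (simp add: tensor_op_rank_one[OF t] op_trace_rank_one b)
  qed
  then show ?thesis
    by (intro tensor_operator_eqI[OF t b] tensor_eqI[OF t])
qed

lemma kraus_has_sum:
  assumes "kraus \<Phi> L K" "bounded_clinear B"
  shows "((\<lambda>l. cinner (K l \<phi>) (B (K l \<psi>))) has_sum cinner \<phi> (\<Phi> B \<psi>)) L"
proof -
  have "((\<lambda>l. cinner \<phi> ((adj (K l) \<circ> B \<circ> K l) \<psi>)) has_sum cinner \<phi> (\<Phi> B \<psi>)) L"
    using assms by (simp add: kraus_def)
  then show ?thesis
    by (rule has_sum_cong[THEN iffD1, rotated]) (use assms in \<open>simp add: kraus_def cinner_adj_right\<close>)
qed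

lemma kraus_norm_sq_has_sum:
  assumes "kraus \<Phi> L K" "\<Phi> id = id"
  shows "((\<lambda>l. (norm (K l x))\<^sup>2) has_sum (norm x)\<^sup>2) L"
  using kraus_has_sum[OF assms(1) bounded_clinear_id, of x x]
  by (intro has_sum_norm_sq_iff[THEN iffD1]) (simp add: assms(2) cinner_self[of x])

lemma cinner_bound_sum_squares:
  assumes "M \<ge> 0" "\<And>x. norm (B x) \<le> M * norm x"
  shows "norm (cinner x (B y)) \<le> M * ((norm x)\<^sup>2 + (norm y)\<^sup>2)"
proof -
  have "norm (cinner x (B y)) \<le> norm x * (M * norm y)"
    using order_trans[OF Cauchy_Schwarz mult_left_mono[OF assms(2)[of y] norm_ge_zero[of x]]] .
  also have "\<dots> \<le> M * ((norm x)\<^sup>2 + (norm y)\<^sup>2)"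
    using mult_left_mono[OF mult_le_sum_squares[of "norm x" "norm y"] assms(1)] by (simp add: mult_ac)
  finally show ?thesis .
qed

lemma kraus_tensor_has_sum:
  fixes t :: "'h::chilbert \<Rightarrow> 'h \<Rightarrow> 'hh::chilbert" and t' :: "'h \<Rightarrow> 'k::chilbert \<Rightarrow> 'hk::chilbert"
  assumes t: "hilbert_tensor t" and t': "hilbert_tensor t'"
    and kraus: "kraus \<Phi> L K" and unital: "\<Phi> id = id"
    and A: "bounded_clinear A" and B: "bounded_clinear B" and \<Phi>B: "bounded_clinear (\<Phi> B)"
  shows "((\<lambda>l. cinner (tensor_op t t' id (K l) u)
        (tensor_op t' t' A B (tensor_op t t' id (K l) v))) has_sum
      cinner u (tensor_op t t A (\<Phi> B) v)) L"
proof -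
  let ?T = "\<lambda>l. tensor_op t t' id (K l)"
  obtain E :: "'h set" where onb: "is_onb E"
    using onb_exists by blast
  obtain M where M: "M \<ge> 0" "\<And>x. norm (B x) \<le> M * norm x"
    using bounded_clinear_bound[OF B] by blast
  have K: "bounded_clinear (K l)" if "l \<in> L" for l
    using kraus that by (simp add: kraus_def)
  \<comment> \<open>A acts on the first factor and K_l on the second, so A can be absorbed into the
    right-hand vector. What remains acts on the second factor only and is computed slice by
    slice.\<close>
  define v' where "v' = tensor_op t t A id v"
  let ?f = "\<lambda>e l. cinner (K l (adj (t e) u)) (B (K l (adj (t e) v')))"
  have v'_\<Phi>: "tensor_op t t A (\<Phi> B) v = tensor_op t t id (\<Phi> B) v'"
    unfolding v'_def using t A \<Phi>B by (simp add: tensor_op_compose bounded_clinear_id)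
  have v'_K: "tensor_op t' t' A B (?T l v) = tensor_op t t' id (B \<circ> K l) v'" if "l \<in> L" for l
    unfolding v'_def using t t' A B K[OF that]
    by (simp add: tensor_op_compose bounded_clinear_id bounded_clinear_comp)
  have "((\<lambda>l. cinner (?T l u) (tensor_op t t' id (B \<circ> K l) v')) has_sum
      cinner u (tensor_op t t A (\<Phi> B) v)) L"
  proof (rule has_sum_interchange)
    show "(\<lambda>(e, l). ?f e l) summable_on E \<times> L"
    proof (rule summable_on_product_dominated)
      show "norm (?f e l) \<le> M * ((norm (K l (adj (t e) u)))\<^sup>2 + (norm (K l (adj (t e) v')))\<^sup>2)" for e l
        by (rule cinner_bound_sum_squares[OF M])
      \<comment> \<open>Unitality gives the row sums: the squared norms of K_l x add up to that of
        x.\<close>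
      show "((\<lambda>l. M * ((norm (K l (adj (t e) u)))\<^sup>2 + (norm (K l (adj (t e) v')))\<^sup>2)) has_sum
          M * ((norm (adj (t e) u))\<^sup>2 + (norm (adj (t e) v'))\<^sup>2)) L" for e
        by (intro has_sum_cmult_right has_sum_add kraus_norm_sq_has_sum[OF kraus unital])
      show "(\<lambda>e. M * ((norm (adj (t e) u))\<^sup>2 + (norm (adj (t e) v'))\<^sup>2)) summable_on E"
        by (intro summable_on_cmult_right summable_on_add has_sum_imp_summable[OF norm_slices[OF t onb]])
    qed
    show "(?f e has_sum cinner (adj (t e) u) (\<Phi> B (adj (t e) v'))) L" for e
      by (rule kraus_has_sum[OF kraus B])
    show "((\<lambda>e. ?f e l) has_sum cinner (?T l u) (tensor_op t t' id (B \<circ> K l) v')) E" if "l \<in> L" for l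
      using cinner_slices[OF t' onb, of "?T l u" "tensor_op t t' id (B \<circ> K l) v'"] K[OF that]
      by (simp add: slice_tensor_op_right[OF t t'] bounded_clinear_comp[OF B])
    show "((\<lambda>e. cinner (adj (t e) u) (\<Phi> B (adj (t e) v'))) has_sum
        cinner u (tensor_op t t A (\<Phi> B) v)) E"
      using cinner_slices[OF t onb, of u "tensor_op t t id (\<Phi> B) v'"]
      by (simp add: slice_tensor_op_right[OF t t \<Phi>B] v'_\<Phi>)
  qed
  then show ?thesis
    by (rule has_sum_cong[THEN iffD1, rotated]) (simp add: v'_K)
qed

lemma cinner_tensor_op_right:
  assumes t: "hilbert_tensor t" and t': "hilbert_tensor t'"
    and K: "bounded_clinear K" and K': "bounded_clinear K'"
  shows "cinner (tensor_op t t' id K u) (tensor_op t t' id K' v) = cinner u (tensor_op t t id (adj K \<circ> K') v)"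
proof (rule has_sum_unique[OF cinner_slices[OF t' is_onb_some]])
  show "((\<lambda>e. cinner (adj (t' e) (tensor_op t t' id K u)) (adj (t' e) (tensor_op t t' id K' v))) has_sum
      cinner u (tensor_op t t id (adj K \<circ> K') v)) (SOME E. is_onb E)"
    using cinner_slices[OF t is_onb_some, of u "tensor_op t t id (adj K \<circ> K') v"]
    by (simp add: slice_tensor_op_right[OF t t'] K K' cinner_adj_right[OF K]
        slice_tensor_op_right[OF t t bounded_clinear_comp[OF bounded_clinear_adj[OF K] K']])
qed

text \<open>The GNS identity has \<open>adj K \<circ> K'\<close> on the first factor of \<Omega>.
  The flip brings it to the second factor, where it splits into K on the left vector and K' on the
  right.\<close>

lemma op_trace_gns:
  assumes t: "hilbert_tensor t" and t': "hilbert_tensor t'" and gns: "minimal_gns t \<rho> \<Omega>"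
    and K: "bounded_clinear K" and K': "bounded_clinear K'"
  shows "op_trace (\<rho> \<circ> adj K \<circ> K') =
    cinner (tensor_op t t' id K (tensor_flip t \<Omega>)) (tensor_op t t' id K' (tensor_flip t \<Omega>))"
proof -
  note KK = bounded_clinear_comp[OF bounded_clinear_adj[OF K] K']
  have "op_trace (\<rho> \<circ> (adj K \<circ> K')) = cinner \<Omega> (tensor_op t t (adj K \<circ> K') id \<Omega>)"
    using gns KK by (simp add: minimal_gns_def)
  then show ?thesis
    by (simp add: comp_assoc cinner_tensor_op_right[OF t t' K K']
        cinner_flipped_tensor_op[OF t bounded_clinear_id KK])
qed

lemma choi_state_of_kraus:
  fixes t :: "'h::chilbert \<Rightarrow> 'h \<Rightarrow> 'hh::chilbert" and t' :: "'h \<Rightarrow> 'k::chilbert \<Rightarrow> 'hk::chilbert"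
    and L :: "'l set"
  assumes t: "hilbert_tensor t" and t': "hilbert_tensor t'" and gns: "minimal_gns t \<rho> \<Omega>"
    and \<Phi>: "\<Phi> \<in> NCH" and kraus: "kraus \<Phi> L K"
    and orth: "\<And>l l'. l \<in> L \<Longrightarrow> l' \<in> L \<Longrightarrow> l \<noteq> l' \<Longrightarrow> op_trace (\<rho> \<circ> adj (K l) \<circ> K l') = 0"
  obtains S where "is_choi_state t t' \<Omega> \<Phi> S"
    and "orthogonal_decomposition S L (\<lambda>l. tensor_op t t' id (K l) (tensor_flip t \<Omega>))"
proof -
  define w where "w l = tensor_op t t' id (K l) (tensor_flip t \<Omega>)" for l
  have unital: "\<Phi> id = id" and \<Phi>B: "\<And>B. bounded_clinear B \<Longrightarrow> bounded_clinear (\<Phi> B)"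
    using \<Phi> by (simp_all add: NCH_def op_linear_def)
  have K: "bounded_clinear (K l)" if "l \<in> L" for l
    using kraus that by (simp add: kraus_def)
  have sum: "((\<lambda>l. cinner (w l) (tensor_op t' t' A B (w l))) has_sum
      cinner \<Omega> (tensor_op t t (\<Phi> B) A \<Omega>)) L" if "bounded_clinear A" "bounded_clinear B" for A B
    using kraus_tensor_has_sum[OF t t' kraus unital that \<Phi>B[OF that(2)],
        of "tensor_flip t \<Omega>" "tensor_flip t \<Omega>"] that \<Phi>B[OF that(2)]
    by (simp add: w_def cinner_flipped_tensor_op[OF t])
  \<comment> \<open>The case A = B = 1: as \<Omega> is a unit vector, the w_l have total squared
    norm 1, which makes the operator built from them a state.\<close>
  have "((\<lambda>l. cinner (w l) (w l)) has_sum cinner \<Omega> \<Omega>) L"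
    using sum[OF bounded_clinear_id bounded_clinear_id]
    by (simp add: unital tensor_op_id[OF t] tensor_op_id[OF t'])
  moreover have "cinner \<Omega> \<Omega> = 1"
    using gns by (simp add: minimal_gns_def cinner_self)
  ultimately have w: "((\<lambda>l. (norm (w l))\<^sup>2) has_sum 1) L"
    using has_sum_norm_sq_iff[of w L 1] by simp
  obtain S where S: "S \<in> states" "\<And>x. ((\<lambda>l. cinner (w l) x *\<^sub>C w l) has_sum S x) L"
    using state_of_decomposition[OF w] by blast
  have "is_choi_state t t' \<Omega> \<Phi> S"
    unfolding is_choi_state_def
  proof (intro conjI allI impI S(1))
    fix A :: "'h \<Rightarrow> 'h" and B :: "'k \<Rightarrow> 'k"
    assume AB: "bounded_clinear A" "bounded_clinear B"
    show "op_trace (S \<circ> tensor_op t' t' A B) = cinner \<Omega> (tensor_op t t (\<Phi> B) A \<Omega>)"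
      by (rule has_sum_unique[OF op_trace_decomposition[OF S(2) has_sum_imp_summable[OF w]
              bounded_clinear_tensor_op[OF t' t' AB]] sum[OF AB]])
  qed
  moreover have "orthogonal_decomposition S L w"
    unfolding orthogonal_decomposition_def
  proof (intro conjI ballI impI allI S(2))
    fix l l' assume "l \<in> L" "l' \<in> L" "l \<noteq> l'"
    then show "cinner (w l) (w l') = 0"
      using orth[of l l'] by (simp add: w_def K op_trace_gns[OF t t' gns])
  qed
  ultimately show ?thesis
    using that by (simp add: w_def[abs_def])
qed

section \<open>Kraus operators from an orthogonal decomposition\<close>

text \<open>\<open>bounded_bilinear\<close> is a notion over the reals, so it covers sesquilinear
  forms. A bound uniform over finite partial sums survives the limit.\<close>

lemma bounded_bilinear_has_sum:
  fixes f :: "'i \<Rightarrow> 'a::real_normed_vector \<Rightarrow> 'b::real_normed_vector \<Rightarrow> 'c::real_normed_vector"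
  assumes f: "\<And>i. i \<in> I \<Longrightarrow> bounded_bilinear (f i)"
    and b: "\<And>x y. ((\<lambda>i. f i x y) has_sum b x y) I"
    and bound: "\<And>x y F. finite F \<Longrightarrow> F \<subseteq> I \<Longrightarrow> norm (\<Sum>i\<in>F. f i x y) \<le> norm x * norm y * M"
  shows "bounded_bilinear b"
proof
  note cong = has_sum_cong[THEN iffD1, rotated]
  show "b (x + x') y = b x y + b x' y" for x x' y
    by (rule has_sum_unique[OF b cong[OF has_sum_add[OF b[of x y] b[of x' y]]]])
      (simp add: bounded_bilinear.add_left[OF f])
  show "b x (y + y') = b x y + b x y'" for x y y'
    by (rule has_sum_unique[OF b cong[OF has_sum_add[OF b[of x y] b[of x y']]]])
      (simp add: bounded_bilinear.add_right[OF f])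
  show "b (r *\<^sub>R x) y = r *\<^sub>R b x y" for r x y
    by (rule has_sum_unique[OF b cong[OF has_sum_scaleR[OF b[of x y]]]])
      (simp add: bounded_bilinear.scaleR_left[OF f])
  show "b x (r *\<^sub>R y) = r *\<^sub>R b x y" for r x y
    by (rule has_sum_unique[OF b cong[OF has_sum_scaleR[OF b[of x y]]]])
      (simp add: bounded_bilinear.scaleR_right[OF f])
  have "norm (b x y) \<le> norm x * norm y * M" for x y
  proof (rule Lim_norm_ubound)
    show "((\<lambda>F. \<Sum>i\<in>F. f i x y) \<longlongrightarrow> b x y) (finite_subsets_at_top I)"
      using b by (simp add: has_sum_def)
    show "\<forall>\<^sub>F F in finite_subsets_at_top I. norm (\<Sum>i\<in>F. f i x y) \<le> norm x * norm y * M"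
      by (intro eventually_finite_subsets_at_top_weakI bound)
  qed simp
  then show "\<exists>M. \<forall>x y. norm (b x y) \<le> norm x * norm y * M"
    by blast
qed

lemma bounded_bilinear_eq_on_dense:
  assumes "bounded_bilinear b" "bounded_bilinear c" and "closure D = UNIV"
    and eq: "\<And>x y. x \<in> D \<Longrightarrow> y \<in> D \<Longrightarrow> b x y = c x y"
  shows "b x y = c x y"
proof -
  have "closed {p. b (fst p) (snd p) = c (fst p) (snd p)}"
    by (intro closed_Collect_eq bounded_bilinear.continuous_on[OF assms(1)]
        bounded_bilinear.continuous_on[OF assms(2)] continuous_intros)
  moreover have "D \<times> D \<subseteq> {p. b (fst p) (snd p) = c (fst p) (snd p)}"
    using eq by auto
  ultimately have "closure (D \<times> D) \<subseteq> {p. b (fst p) (snd p) = c (fst p) (snd p)}"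
    by (intro closure_minimal)
  moreover have "(x, y) \<in> closure (D \<times> D)"
    using assms(3) by (simp add: closure_Times)
  ultimately show ?thesis
    by auto
qed

text \<open>Continuity in x is clear only for a finite part of the series. On D that part is bounded
  by the total, and this inequality extends to the closure.\<close>

lemma contraction_sum_on_dense:
  fixes K :: "'l \<Rightarrow> 'a::chilbert \<Rightarrow> 'b::chilbert"
  assumes K: "\<And>l. l \<in> L \<Longrightarrow> bounded_clinear (K l)" and dense: "closure D = UNIV"
    and D: "\<And>x. x \<in> D \<Longrightarrow> ((\<lambda>l. (norm (K l x))\<^sup>2) has_sum (norm x)\<^sup>2) L"
    and F: "finite F" "F \<subseteq> L"
  shows "(\<Sum>l\<in>F. (norm (K l x))\<^sup>2) \<le> (norm x)\<^sup>2"
proof -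
  have "closed {x. (\<Sum>l\<in>F. (norm (K l x))\<^sup>2) \<le> (norm x)\<^sup>2}"
    using F K by (intro closed_Collect_le continuous_intros bounded_clinear_continuous) auto
  moreover have "D \<subseteq> {x. (\<Sum>l\<in>F. (norm (K l x))\<^sup>2) \<le> (norm x)\<^sup>2}"
    using finite_sum_le_has_sum[OF D F] by auto
  ultimately show ?thesis
    using closure_minimal dense by blast
qed

text \<open>The Kraus series is controlled by the Cauchy-Schwarz inequality for finite partial sums,
  so that it defines a bounded sesquilinear form.\<close>

lemma kraus_if_kraus_on_dense:
  fixes K :: "'l \<Rightarrow> 'a::chilbert \<Rightarrow> 'b::chilbert"
  assumes K: "\<And>l. l \<in> L \<Longrightarrow> bounded_clinear (K l)" and "L \<noteq> {}" and dense: "closure D = UNIV"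
    and unital: "\<Phi> id = id"
    and \<Phi>: "\<And>B. bounded_clinear B \<Longrightarrow> bounded_clinear (\<Phi> B)"
    and D: "\<And>B x y. bounded_clinear B \<Longrightarrow> x \<in> D \<Longrightarrow> y \<in> D \<Longrightarrow>
      ((\<lambda>l. cinner (K l x) (B (K l y))) has_sum cinner x (\<Phi> B y)) L"
  shows "kraus \<Phi> L K"
proof -
  have contraction: "(\<Sum>l\<in>F. (norm (K l x))\<^sup>2) \<le> (norm x)\<^sup>2" if "finite F" "F \<subseteq> L" for x F
  proof (rule contraction_sum_on_dense[OF K dense _ that])
    show "((\<lambda>l. (norm (K l x))\<^sup>2) has_sum (norm x)\<^sup>2) L" if "x \<in> D" for x
      using D[OF bounded_clinear_id that that]
      by (intro has_sum_norm_sq_iff[THEN iffD1]) (simp add: unital cinner_self[of x])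
  qed
  then have summable: "(\<lambda>l. (norm (K l x))\<^sup>2) summable_on L" for x
    by (intro nonneg_bdd_above_summable_on bdd_aboveI2) auto
  have "((\<lambda>l. cinner (K l x) (B (K l y))) has_sum cinner x (\<Phi> B y)) L" if B: "bounded_clinear B" for B x y
  proof -
    obtain M where M: "M \<ge> 0" "\<And>x. norm (B x) \<le> M * norm x"
      using bounded_clinear_bound[OF B] by blast
    \<comment> \<open>The series converges for all x and y, but its value is so far known only on D;
      b names it elsewhere.\<close>
    define b where "b x y = infsum (\<lambda>l. cinner (K l x) (B (K l y))) L" for x y
    have b: "((\<lambda>l. cinner (K l x) (B (K l y))) has_sum b x y) L" for x y
    proof -
      have "(\<lambda>l. norm (cinner (K l x) (B (K l y)))) summable_on L"
        using summable_on_cmult_right[OF summable_on_add[OF summable[of x] summable[of y]], of M]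
          cinner_bound_sum_squares[OF M]
        by (rule Infinite_Sum.abs_summable_on_comparison_test')
      then show ?thesis
        unfolding b_def by (intro has_sum_infsum) (rule abs_summable_summable)
    qed
    have "bounded_bilinear b"
    proof (rule bounded_bilinear_has_sum[OF _ b])
      show "bounded_bilinear (\<lambda>x y. cinner (K l x) (B (K l y)))" if "l \<in> L" for l
        using bounded_clinear_bounded_linear[OF K[OF that]]
          bounded_clinear_bounded_linear[OF bounded_clinear_compose[OF B K[OF that]]]
        by (rule cinner.comp)
      fix x y F assume F: "finite F" "F \<subseteq> L"
      have "norm (\<Sum>l\<in>F. cinner (K l x) (B (K l y))) \<le> (\<Sum>l\<in>F. norm (cinner (K l x) (B (K l y))))"
        by (rule norm_sum)
      also have "\<dots> \<le> (\<Sum>l\<in>F. M * (norm (K l x) * norm (K l y)))"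
      proof (rule sum_mono)
        show "norm (cinner (K l x) (B (K l y))) \<le> M * (norm (K l x) * norm (K l y))" for l
          using order_trans[OF Cauchy_Schwarz mult_left_mono[OF M(2)[of "K l y"] norm_ge_zero[of "K l x"]]]
          by (simp add: mult_ac)
      qed
      also have "\<dots> = M * (\<Sum>l\<in>F. \<bar>norm (K l x)\<bar> * \<bar>norm (K l y)\<bar>)"
        by (simp add: sum_distrib_left)
      \<comment> \<open>Termwise domination by sums of squares gives no bound by the product of the
        norms; Cauchy-Schwarz for the finite sum does.\<close>
      also have "\<dots> \<le> M * (L2_set (\<lambda>l. norm (K l x)) F * L2_set (\<lambda>l. norm (K l y)) F)"
        by (intro mult_left_mono L2_set_mult_ineq M)
      also have "\<dots> \<le> M * (norm x * norm y)"
        unfolding L2_set_def using contraction[OF F]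
        by (intro mult_left_mono mult_mono M) (simp_all add: real_le_lsqrt sum_nonneg)
      finally show "norm (\<Sum>l\<in>F. cinner (K l x) (B (K l y))) \<le> norm x * norm y * M"
        by (simp add: mult_ac)
    qed
    moreover have "bounded_bilinear (\<lambda>x y. cinner x (\<Phi> B y))"
      by (rule cinner.comp[OF bounded_linear_ident bounded_clinear_bounded_linear[OF \<Phi>[OF B]]])
    moreover have "b x y = cinner x (\<Phi> B y)" if "x \<in> D" "y \<in> D" for x y
      using has_sum_unique[OF b D[OF B that]] .
    ultimately have "b x y = cinner x (\<Phi> B y)"
      by (rule bounded_bilinear_eq_on_dense[OF _ _ dense])
    with b[of x y] show ?thesis
      by simp
  qed
  note sum = this
  have "((\<lambda>l. cinner x ((adj (K l) \<circ> B \<circ> K l) y)) has_sum cinner x (\<Phi> B y)) L"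
    if B: "bounded_clinear B" for B x y
    by (rule has_sum_cong[THEN iffD1, rotated, OF sum[OF B]]) (simp add: cinner_adj_right K)
  with K \<open>L \<noteq> {}\<close> show ?thesis
    by (simp add: kraus_def)
qed

section \<open>Slices of the flipped GNS vector\<close>

lemma slice_add:
  assumes "hilbert_tensor t"
  shows "adj (t (x + y)) u = adj (t x) u + adj (t y) u"
  by (rule cinner_ext)
    (simp add: cinner_slice_right[OF assms] tensor_add_left[OF assms] cinner_add_left cinner_add_right)

lemma slice_scaleC:
  assumes "hilbert_tensor t"
  shows "adj (t (c *\<^sub>C x)) u = cnj c *\<^sub>C adj (t x) u"
  by (rule cinner_ext)
    (simp add: cinner_slice_right[OF assms] tensor_scaleC_left[OF assms] cinner_scaleC_left cinner_scaleC_right)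

text \<open>If y is orthogonal to all slices u_x, then 1 \<otimes> |y><y| annihilates the flipped
  vector, because the resulting slices are <y|u_x> y. The GNS identity for |y><y| gives <y|\<rho> y>
  = 0; positivity yields \<rho> y = 0, and injectivity y = 0.\<close>

lemma dense_slices_gns:
  fixes t :: "'h::chilbert \<Rightarrow> 'h \<Rightarrow> 'hh::chilbert"
  assumes t: "hilbert_tensor t" and gns: "minimal_gns t \<rho> \<Omega>" and \<rho>: "\<rho> \<in> states" "faithful \<rho>"
  shows "closure (range (\<lambda>x. adj (t x) (tensor_flip t \<Omega>))) = UNIV"
proof (rule dense_if_orthogonal_trivial)
  let ?R = "\<lambda>x. adj (t x) (tensor_flip t \<Omega>)"
  have add: "?R x + ?R y = ?R (x + y)" and scale: "c *\<^sub>C ?R x = ?R (cnj c *\<^sub>C x)" for c x y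
    by (simp_all add: slice_add[OF t] slice_scaleC[OF t])
  have "?R (0 *\<^sub>C 0) = 0"
    unfolding slice_scaleC[OF t] by simp
  then show "complex_subspace (range ?R)"
    unfolding complex_subspace_def add scale by (auto simp: image_iff add scale)
  fix y assume y: "\<And>m. m \<in> range ?R \<Longrightarrow> cinner m y = 0"
  have "tensor_op t t id (rank_one y y) (tensor_flip t \<Omega>) = 0"
  proof (rule tensor_eqI_slice[OF t])
    fix x
    have "cinner y (?R x) = 0"
      using y[of "?R x"] cinner_commute[of y "?R x"] by simp
    then show "adj (t x) (tensor_op t t id (rank_one y y) (tensor_flip t \<Omega>)) = adj (t x) 0"
      unfolding slice_tensor_op_right[OF t t bounded_clinear_rank_one]
      by (simp add: rank_one_def bounded_clinear_zero[OF bounded_clinear_slice[OF t]])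
  qed
  then have "cinner \<Omega> (tensor_op t t (rank_one y y) id \<Omega>) = 0"
    using cinner_flipped_tensor_op[OF t bounded_clinear_id bounded_clinear_rank_one, of \<Omega> y y \<Omega>]
    by (simp add: cinner.zero_right)
  moreover have pos: "positive_op \<rho>" and b\<rho>: "bounded_clinear \<rho>"
    using \<rho> by (auto simp: states_def positive_op_def)
  ultimately have "cinner y (\<rho> y) = 0"
    using gns by (simp add: minimal_gns_def bounded_clinear_rank_one op_trace_rank_one)
  then have "\<rho> y = \<rho> 0"
    using positive_op_eq_zero[OF pos] bounded_clinear_zero[OF b\<rho>] by simp
  then show "y = 0"
    using \<rho>(2) by (simp add: faithful_def inj_eq)
qed

lemma kraus_of_choi_state:
  fixes t :: "'h::chilbert \<Rightarrow> 'h \<Rightarrow> 'hh::chilbert" and t' :: "'h \<Rightarrow> 'k::chilbert \<Rightarrow> 'hk::chilbert"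
    and L :: "'l set"
  assumes t: "hilbert_tensor t" and t': "hilbert_tensor t'" and gns: "minimal_gns t \<rho> \<Omega>"
    and \<rho>: "\<rho> \<in> states" "faithful \<rho>" and \<Phi>: "\<Phi> \<in> NCH"
    and choi: "is_choi_state t t' \<Omega> \<Phi> S"
    and decomposition: "orthogonal_decomposition S L w" and "L \<noteq> {}" and nz: "\<And>l. l \<in> L \<Longrightarrow> w l \<noteq> 0"
  obtains K where "minimal_kraus \<Phi> L K"
    and "\<And>l. l \<in> L \<Longrightarrow> w l = tensor_op t t' id (K l) (tensor_flip t \<Omega>)"
proof -
  have unital: "\<Phi> id = id" and \<Phi>B: "\<And>B. bounded_clinear B \<Longrightarrow> bounded_clinear (\<Phi> B)"
    using \<Phi> by (simp_all add: NCH_def op_linear_def)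
  have orth: "\<And>l l'. l \<in> L \<Longrightarrow> l' \<in> L \<Longrightarrow> l \<noteq> l' \<Longrightarrow> cinner (w l) (w l') = 0"
    and S: "\<And>x. ((\<lambda>l. cinner (w l) x *\<^sub>C w l) has_sum S x) L"
    using decomposition by (auto simp: orthogonal_decomposition_def)
  have w: "((\<lambda>l. (norm (w l))\<^sup>2) has_sum 1) L"
    using choi by (intro decomposition_norm_sq_has_sum[OF _ S]) (simp add: is_choi_state_def)
  define \<Omega>' where "\<Omega>' = tensor_flip t \<Omega>"
  define R where "R x = adj (t x) \<Omega>'" for x
  define W where "W l x = adj (t' x) (w l)" for l x
  have dense: "closure (range R) = UNIV"
    using dense_slices_gns[OF t gns \<rho>] by (simp add: R_def[abs_def] \<Omega>'_def)
  have WR: "((\<lambda>l. cinner (W l x) (B (W l y))) has_sum cinner (R x) (\<Phi> B (R y))) L"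
    if B: "bounded_clinear B" for B x y
  proof -
    let ?C = "tensor_op t' t' (rank_one x y) B"
    have "((\<lambda>l. cinner (w l) (?C (w l))) has_sum op_trace (S \<circ> ?C)) L"
      by (intro op_trace_decomposition[OF S has_sum_imp_summable[OF w]]
          bounded_clinear_tensor_op[OF t' t'] bounded_clinear_rank_one B)
    also have "op_trace (S \<circ> ?C) = cinner \<Omega> (tensor_op t t (\<Phi> B) (rank_one x y) \<Omega>)"
      using choi B by (simp add: is_choi_state_def bounded_clinear_rank_one)
    also have "\<dots> = cinner \<Omega>' (tensor_op t t (rank_one x y) (\<Phi> B) \<Omega>')"
      by (simp add: \<Omega>'_def cinner_flipped_tensor_op[OF t bounded_clinear_rank_one \<Phi>B[OF B]])
    finally show ?thesis
      by (simp add: tensor_op_rank_one_left[OF t' B] tensor_op_rank_one_left[OF t \<Phi>B[OF B]]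
          W_def R_def cinner_slice_left[OF t] cinner_slice_left[OF t'])
  qed
  have WR_norm: "((\<lambda>l. (norm (W l x))\<^sup>2) has_sum (norm (R x))\<^sup>2) L" for x
    using WR[OF bounded_clinear_id, of x x]
    by (intro has_sum_norm_sq_iff[THEN iffD1]) (simp add: unital cinner_self[of "R x"])
  have "\<exists>k. bounded_clinear k \<and> (\<forall>x. k (R x) = W l x)" if "l \<in> L" for l
  proof -
    \<comment> \<open>One term of the non-negative series \<open>WR_norm\<close> is at most its sum,
      hence the constant 1.\<close>
    have "norm (W l x) \<le> 1 * norm (R x)" for x
      using finite_sum_le_has_sum[OF WR_norm[of x], of "{l}"] that by (simp add: power2_le_iff_abs_le)
    moreover have "\<exists>z. R z = R x + R y \<and> W l z = W l x + W l y" for x y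
      by (intro exI[of _ "x + y"]) (simp add: R_def W_def slice_add[OF t] slice_add[OF t'])
    \<comment> \<open>Slices are antilinear in x, so c times the slice at x is the slice at the
      conjugate multiple.\<close>
    moreover have "\<exists>z. R z = c *\<^sub>C R x \<and> W l z = c *\<^sub>C W l x" for c x
      by (intro exI[of _ "cnj c *\<^sub>C x"]) (simp add: R_def W_def slice_scaleC[OF t] slice_scaleC[OF t'])
    ultimately obtain k where "bounded_clinear k" "\<And>x. k (R x) = W l x"
      using dense_extension[OF dense, of "W l" 1] by blast
    then show ?thesis
      by blast
  qed
  then have "\<forall>l\<in>L. \<exists>k. bounded_clinear k \<and> (\<forall>x. k (R x) = W l x)"
    by blast
  from bchoice[OF this] obtain K where "\<forall>l\<in>L. bounded_clinear (K l) \<and> (\<forall>x. K l (R x) = W l x)"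
    by (rule exE)
  then have K: "\<And>l. l \<in> L \<Longrightarrow> bounded_clinear (K l)" and KR: "\<And>l x. l \<in> L \<Longrightarrow> K l (R x) = W l x"
    by auto
  have "kraus \<Phi> L K"
  proof (rule kraus_if_kraus_on_dense[where \<Phi> = \<Phi>, OF K \<open>L \<noteq> {}\<close> dense unital \<Phi>B])
    fix B :: "'k \<Rightarrow> 'k" and x' y'
    assume B: "bounded_clinear B" and "x' \<in> range R" "y' \<in> range R"
    then obtain x y where xy: "x' = R x" "y' = R y"
      by blast
    show "((\<lambda>l. cinner (K l x') (B (K l y'))) has_sum cinner x' (\<Phi> B y')) L"
      unfolding xy by (rule has_sum_cong[THEN iffD1, rotated, OF WR[OF B]]) (simp add: KR)
  qed
  moreover have "weakly_independent L K"
    unfolding weakly_independent_def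
  proof (intro allI impI ballI)
    fix \<alpha> :: "'l \<Rightarrow> complex" and m
    assume \<alpha>: "(\<lambda>l. (cmod (\<alpha> l))\<^sup>2) summable_on L" "m \<in> L"
      and zero: "\<forall>\<phi> \<psi>. ((\<lambda>l. \<alpha> l * cinner \<psi> (K l \<phi>)) has_sum 0) L"
    \<comment> \<open>Orthogonality makes square-summable coefficients sufficient for the \<alpha>_l
      w_l to be summable; the assumed relation then speaks of their sum z.\<close>
    have orth': "cinner (\<alpha> l *\<^sub>C w l) (\<alpha> l' *\<^sub>C w l') = 0" if "l \<in> L" "l' \<in> L" "l \<noteq> l'" for l l'
      using orth[OF that] by (simp add: cinner_scaleC_left cinner_scaleC_right)
    have "(norm (\<alpha> l *\<^sub>C w l))\<^sup>2 \<le> (cmod (\<alpha> l))\<^sup>2" if "l \<in> L" for l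
    proof -
      have "(norm (w l))\<^sup>2 \<le> 1"
        using finite_sum_le_has_sum[OF w, of "{l}"] that by simp
      from mult_left_mono[OF this, of "(cmod (\<alpha> l))\<^sup>2"] show ?thesis
        by (simp add: norm_scaleC power_mult_distrib)
    qed
    from summable_on_comparison_test[OF \<alpha>(1) this]
    have "(\<lambda>l. (norm (\<alpha> l *\<^sub>C w l))\<^sup>2) summable_on L"
      by simp
    with orth' have "(\<lambda>l. \<alpha> l *\<^sub>C w l) summable_on L"
      by (rule orthogonal_summable_on)
    then obtain z where z: "((\<lambda>l. \<alpha> l *\<^sub>C w l) has_sum z) L"
      by (auto simp: summable_on_def)
    \<comment> \<open>Pairing w_l with t' x y gives <y|K_l (R x)>, so the relation is used with
      \<phi> = R x and \<psi> = y.\<close>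
    have "cinner (t' x y) z = cinner (t' x y) 0" for x y
    proof -
      have "((\<lambda>l. cinner (t' x y) (\<alpha> l *\<^sub>C w l)) has_sum cinner (t' x y) z) L"
        by (rule has_sum_bounded_linear[OF cinner.bounded_linear_right z])
      moreover have "((\<lambda>l. cinner (t' x y) (\<alpha> l *\<^sub>C w l)) has_sum 0) L"
        by (rule has_sum_cong[THEN iffD1, rotated, OF zero[rule_format, of y "R x"]])
          (simp add: KR W_def cinner_slice_right[OF t'] cinner_scaleC_right)
      ultimately show ?thesis
        using has_sum_unique by (fastforce simp: cinner.zero_right)
    qed
    then have "z = 0"
      by (rule tensor_eqI[OF t'])
    with orthogonal_has_sum_norm_sq[OF orth' z]
    have "((\<lambda>l. (norm (\<alpha> l *\<^sub>C w l))\<^sup>2) has_sum 0) L"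
      by simp
    then have "(norm (\<alpha> m *\<^sub>C w m))\<^sup>2 = 0"
      using \<alpha>(2) by (intro nonneg_has_sum_le_0D[of _ _ 0]) auto
    then show "\<alpha> m = 0"
      using nz[OF \<alpha>(2)] by (simp add: norm_scaleC)
  qed
  ultimately have "minimal_kraus \<Phi> L K"
    by (simp add: minimal_kraus_def)
  moreover have "w l = tensor_op t t' id (K l) (tensor_flip t \<Omega>)" if "l \<in> L" for l
    using KR[OF that]
    by (intro tensor_eqI_slice[OF t'])
      (simp add: slice_tensor_op_right[OF t t' K[OF that]] R_def W_def \<Omega>'_def)
  ultimately show ?thesis
    using that by blast
qed

text \<open>The state named in part (a) is a determinate object, so its existence and uniqueness
  belong to the claim. The index types of the two parts are independent because the parts speak of
  unrelated families.\<close>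

theorem proposition1:
  fixes tHH :: "'h::chilbert \<Rightarrow> 'h \<Rightarrow> 'hh::chilbert"
    and tHK :: "'h \<Rightarrow> 'k::chilbert \<Rightarrow> 'hk::chilbert"
    and \<rho>\<^sub>0 :: "'h \<Rightarrow> 'h" and \<Omega> :: 'hh
  assumes "separable_type TYPE('h)"
    and "hilbert_tensor tHH" and "hilbert_tensor tHK"
    and "\<rho>\<^sub>0 \<in> states" and "faithful \<rho>\<^sub>0"
    and "minimal_gns tHH \<rho>\<^sub>0 \<Omega>"
  shows
    "(\<forall>(\<Phi> :: ('k \<Rightarrow> 'k) \<Rightarrow> 'h \<Rightarrow> 'h) (L :: 'l set) K.
        \<Phi> \<in> NCH \<and> L \<noteq> {} \<and> kraus \<Phi> L K \<and>
        (\<forall>l\<in>L. \<forall>l'\<in>L. l \<noteq> l' \<longrightarrow> op_trace (\<rho>\<^sub>0 \<circ> adj (K l) \<circ> K l') = 0) \<longrightarrow>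
        (\<exists>!S. is_choi_state tHH tHK \<Omega> \<Phi> S) \<and>
        (\<forall>S. is_choi_state tHH tHK \<Omega> \<Phi> S \<longrightarrow>
          orthogonal_decomposition S L
            (\<lambda>l. tensor_op tHH tHK id (K l) (tensor_flip tHH \<Omega>)))) \<and>
     (\<forall>S (\<Phi> :: ('k \<Rightarrow> 'k) \<Rightarrow> 'h \<Rightarrow> 'h) (L :: 'm set) w.
        S \<in> states \<and> partial_trace tHK S = \<rho>\<^sub>0 \<and>
        \<Phi> \<in> NCH \<and> is_choi_state tHH tHK \<Omega> \<Phi> S \<and>
        L \<noteq> {} \<and> orthogonal_decomposition S L w \<and> (\<forall>l\<in>L. w l \<noteq> 0) \<longrightarrow>
        (\<exists>K. minimal_kraus \<Phi> L K \<and>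
          (\<forall>l\<in>L. \<forall>l'\<in>L. l \<noteq> l' \<longrightarrow> op_trace (\<rho>\<^sub>0 \<circ> adj (K l) \<circ> K l') = 0) \<and>
          (\<forall>l\<in>L. w l = tensor_op tHH tHK id (K l) (tensor_flip tHH \<Omega>))))"
proof (rule conjI; intro allI impI; elim conjE)
  note t = assms(2,3) and gns = assms(6)
  fix \<Phi> :: "('k \<Rightarrow> 'k) \<Rightarrow> 'h \<Rightarrow> 'h" and L :: "'l set" and K
  assume \<Phi>: "\<Phi> \<in> NCH" and kraus: "kraus \<Phi> L K"
    and orth: "\<forall>l\<in>L. \<forall>l'\<in>L. l \<noteq> l' \<longrightarrow> op_trace (\<rho>\<^sub>0 \<circ> adj (K l) \<circ> K l') = 0"
  let ?w = "\<lambda>l. tensor_op tHH tHK id (K l) (tensor_flip tHH \<Omega>)"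
  obtain S where "is_choi_state tHH tHK \<Omega> \<Phi> S" "orthogonal_decomposition S L ?w"
    by (rule choi_state_of_kraus[OF t gns \<Phi> kraus]) (use orth in auto)
  then show "(\<exists>!S. is_choi_state tHH tHK \<Omega> \<Phi> S) \<and>
      (\<forall>S. is_choi_state tHH tHK \<Omega> \<Phi> S \<longrightarrow> orthogonal_decomposition S L ?w)"
    using choi_state_unique[OF t(2)] by blast
next
  note t = assms(2,3) and gns = assms(6)
  fix S and \<Phi> :: "('k \<Rightarrow> 'k) \<Rightarrow> 'h \<Rightarrow> 'h" and L :: "'m set" and w
  assume \<Phi>: "\<Phi> \<in> NCH" and choi: "is_choi_state tHH tHK \<Omega> \<Phi> S"
    and L: "L \<noteq> {}" and decomposition: "orthogonal_decomposition S L w" and nz: "\<forall>l\<in>L. w l \<noteq> 0"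
  obtain K where K: "minimal_kraus \<Phi> L K"
    and w: "\<And>l. l \<in> L \<Longrightarrow> w l = tensor_op tHH tHK id (K l) (tensor_flip tHH \<Omega>)"
    by (rule kraus_of_choi_state[OF t gns assms(4,5) \<Phi> choi decomposition L]) (use nz in auto)
  have "op_trace (\<rho>\<^sub>0 \<circ> adj (K l) \<circ> K l') = 0" if "l \<in> L" "l' \<in> L" "l \<noteq> l'" for l l'
  proof -
    \<comment> \<open>The Gram identity of part (a), now read from the vectors to the Kraus
      operators.\<close>
    have "op_trace (\<rho>\<^sub>0 \<circ> adj (K l) \<circ> K l') = cinner (w l) (w l')"
      using K that by (simp add: w op_trace_gns[OF t gns] minimal_kraus_def kraus_def)
    then show ?thesis
      using decomposition that by (simp add: orthogonal_decomposition_def)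
  qed
  with K w show "\<exists>K. minimal_kraus \<Phi> L K \<and>
      (\<forall>l\<in>L. \<forall>l'\<in>L. l \<noteq> l' \<longrightarrow> op_trace (\<rho>\<^sub>0 \<circ> adj (K l) \<circ> K l') = 0) \<and>
      (\<forall>l\<in>L. w l = tensor_op tHH tHK id (K l) (tensor_flip tHH \<Omega>))"
    by blast
qed

end
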